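(* The following $\mathbb{R}$-linear maps generate irreducible real Clifford modules. (1) $c_{1,0}:\mathbb{R}\to\mathrm{End}_{\mathbb{R}}(\mathbb{R})$, $c_{1,0}(x)y=xy$, giving an irreducible action of $C\ell_{1,0}$ on $\mathbb{R}$. (2) With $e_1,e_2$ a $g_{2,0}$-orthonormal basis of $\mathbb{R}^2$ and $f_1$ a spanning vector for $\mathbb{R}$, the $\mathbb{R}$-linear map $c_{2,0}$ given by $c_{2,0}(e_1)=f_1\wedge_{\mathbb{R}}+\iota_{f_1}$, $c_{2,0}(e_2)=\epsilon$, giving an irreducible action of $C\ell_{2,0}$ on $\wedge_{\mathbb{R}}\mathbb{R}$. (3) With $e_1,e_2,e_3$ a $g_{3,0}$-orthonormal basis of $\mathbb{R}^3$ and $f_1$ a spanning vector for $\mathbb{C}$ with Hermitian dual $\overline{f}_1\in\mathbb{C}^*$, the $\mathbb{R}$-linear map $c_{3,0}$ given by the complex linear operators $c_{3,0}(e_1)=f_1\wedge_{\mathbb{C}}+\iota_{\overline{f}_1}$, $c_{3,0}(e_2)=if_1\wedge_{\mathbb{C}}-i\,\iota_{\overline{f}_1}$, $c_{3,0}(e_3)=\epsilon$, giving an irreducible action of $C\ell_{3,0}$ on $\wedge_{\mathbb{C}}\mathbb{C}$. (4) $c_{4,0}:\mathbb{R}^4=\mathbb{H}\to\mathrm{End}^R_{\mathbb{H}}(\wedge_{\mathbb{H}}\mathbb{H})$, $c_{4,0}(q)=\varepsilon_q^L+\iota_q^L$, giving an irreducible action of $C\ell_{4,0}$ on $\wedge_{\mathbb{H}}\mathbb{H}$.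 (5) For every $i\ge1$, on $\mathbb{R}^i\oplus(\mathbb{R}^i)^*$ with the metric $g((x,\omega),(y,\tau))=\omega(y)+\tau(x)$, which has signature $(i,i)$, the map $c_{i,i}:\mathbb{R}^i\oplus(\mathbb{R}^i)^*\to\mathrm{End}_{\mathbb{R}}(\wedge_{\mathbb{R}}\mathbb{R}^i)$, $c_{i,i}(x,\omega)=x\wedge_{\mathbb{R}}-\iota_\omega$, giving an irreducible action of $C\ell_{i,i}$ on $\wedge_{\mathbb{R}}\mathbb{R}^i$; this representation is $\mathbb{Z}_2$-graded by the even/odd grading on multivectors.
   Context: For a nondegenerate symmetric bilinear form $g$ on $V$, the Clifford algebra has relations $v\cdot w+w\cdot v=-2g(v,w)$. $C\ell_{r,s}$ is the Clifford algebra of $\mathbb{R}^{r+s}$ with form $g_{r,s}$ whose matrix in an orthonormal basis has $r$ entries $-1$ and $s$ entries $+1$; in particular a $g_{n,0}$-orthonormal basis has $g_{n,0}(e_j,e_l)=-\delta_{jl}$. $\epsilon$ is the grading-by-degree operator: $+1$ on even and $-1$ on odd multivectors. $\iota$ denotes contraction: by $f_1$ using the inner product of $\mathbb{R}$, by $\overline{f}_1$ or $\omega$ as a dual vector. $\wedge_{\mathbb{H}}\mathbb{H}$ is the quotient of the tensor algebra of the bimodule $\mathbb{H}$ over $\mathbb{H}$ by the ideal generated by the elements $m\otimes_{\mathbb{H}}m$, and is identified with $\wedge^0\oplus\wedge^1=\mathbb{H}\oplus\mathbb{H}$; for $q\in\mathbb{H}$, $\varepsilon^L_q(a,b)=(0,qa)$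 and $\iota^L_q(a,b)=(\overline{q}b,0)$. $\mathrm{End}^R_{\mathbb{H}}$ denotes right $\mathbb{H}$-linear endomorphisms.
   Formalization: In (2),(3) f_1 is a unit vector, since c(e_1)^2=|f_1|^2 must be 1; in (5), c_{i,i}(x,ω)^2=-ω(x) while -g gives -2ω(x), so the claim is made for c_{i,i} with the metric g/2 and for √2·c_{i,i} with g. *)

theory Defs
  imports
    "HOL-Analysis.Analysis"
    "HOL-Library.Poly_Mapping"
    "HOL-Algebra.QuotRing"
begin

section \<open>Quadratic spaces\<close>

definition has_signature :: "('v::real_vector \<Rightarrow> 'v \<Rightarrow> real) \<Rightarrow> nat \<Rightarrow> nat \<Rightarrow> bool" where
  "has_signature g r s \<longleftrightarrow>
     (\<forall>v. linear (g v)) \<and> (\<forall>v w. g v w = g w v) \<and>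
     (\<exists>N P. finite N \<and> card N = r \<and> finite P \<and> card P = s \<and> N \<inter> P = {} \<and>
        independent (N \<union> P) \<and> span (N \<union> P) = UNIV \<and>
        (\<forall>v \<in> N \<union> P. \<forall>w \<in> N \<union> P.
           g v w = (if v \<noteq> w then 0 else if v \<in> N then - 1 else 1)))"

definition neg_inner :: "'v::real_inner \<Rightarrow> 'v \<Rightarrow> real" where
  "neg_inner v w = - (v \<bullet> w)"


section \<open>Clifford algebras\<close>

text \<open>
  The Clifford algebra is presented by generators and relations: the free unital associative
  real algebra on the set underlying the vector space, modulo linearity in the generators
  (which alone gives the tensor algebra) and the Clifford relations.
\<close>

datatype 'a free_monoid = Word (letters: "'a list")

instantiation free_monoid :: (type) monoid_add
begin

definition zero_free_monoid :: "'a free_monoid" where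
  "zero_free_monoid = Word []"

definition plus_free_monoid :: "'a free_monoid \<Rightarrow> 'a free_monoid \<Rightarrow> 'a free_monoid" where
  "plus_free_monoid u w = Word (letters u @ letters w)"

instance
  by standard (simp_all add: zero_free_monoid_def plus_free_monoid_def)

end

type_synonym 'v free_alg = "'v free_monoid \<Rightarrow>\<^sub>0 real"

definition free_algebra :: "'v free_alg ring" where
  "free_algebra = \<lparr>carrier = UNIV, mult = (*), one = 1, zero = 0, add = (+)\<rparr>"

definition generator :: "'v \<Rightarrow> 'v free_alg" where
  "generator v = Poly_Mapping.single (Word [v]) 1"

definition scalar :: "real \<Rightarrow> 'v free_alg" where
  "scalar r = Poly_Mapping.single 0 r"

definition clifford_relators :: "('v::real_vector \<Rightarrow> 'v \<Rightarrow> real) \<Rightarrow> 'v free_alg set" where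
  "clifford_relators g =
     (\<Union>v w. {generator (v + w) - generator v - generator w}) \<union>
     (\<Union>r v. {generator (r *\<^sub>R v) - scalar r * generator v}) \<union>
     (\<Union>v w. {generator v * generator w + generator w * generator v + scalar (2 * g v w)})"

definition clifford_ideal :: "('v::real_vector \<Rightarrow> 'v \<Rightarrow> real) \<Rightarrow> 'v free_alg set" where
  "clifford_ideal g = genideal free_algebra (clifford_relators g)"

definition clifford_algebra :: "('v::real_vector \<Rightarrow> 'v \<Rightarrow> real) \<Rightarrow> 'v free_alg set ring" where
  "clifford_algebra g = FactRing free_algebra (clifford_ideal g)"

definition clifford_class :: "('v::real_vector \<Rightarrow> 'v \<Rightarrow> real) \<Rightarrow> 'v free_alg \<Rightarrow> 'v free_alg set" where
  "clifford_class g t = a_r_coset free_algebra (clifford_ideal g) t"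

definition clifford_even :: "('v::real_vector \<Rightarrow> 'v \<Rightarrow> real) \<Rightarrow> 'v free_alg set set" where
  "clifford_even g = clifford_class g ` {t. \<forall>u \<in> Poly_Mapping.keys t. even (length (letters u))}"

definition clifford_odd :: "('v::real_vector \<Rightarrow> 'v \<Rightarrow> real) \<Rightarrow> 'v free_alg set set" where
  "clifford_odd g = clifford_class g ` {t. \<forall>u \<in> Poly_Mapping.keys t. odd (length (letters u))}"


section \<open>Clifford modules\<close>

definition endomorphism_ring :: "('w::real_vector \<Rightarrow> 'w) ring" where
  "endomorphism_ring =
     \<lparr>carrier = {f. linear f}, mult = (\<circ>), one = id, zero = (\<lambda>x. 0), add = (\<lambda>f h x. f x + h x)\<rparr>"

definition clifford_action ::
    "('v::real_vector \<Rightarrow> 'v \<Rightarrow> real) \<Rightarrow> ('v free_alg set \<Rightarrow> 'w::real_vector \<Rightarrow> 'w) \<Rightarrow> bool" where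
  "clifford_action g \<rho> \<longleftrightarrow>
     \<rho> \<in> ring_hom (clifford_algebra g) endomorphism_ring \<and>
     (\<forall>r. \<rho> (clifford_class g (scalar r)) = (\<lambda>x. r *\<^sub>R x))"

definition irreducible_action ::
    "('v::real_vector \<Rightarrow> 'v \<Rightarrow> real) \<Rightarrow> ('v free_alg set \<Rightarrow> 'w::real_vector \<Rightarrow> 'w) \<Rightarrow> bool" where
  "irreducible_action g \<rho> \<longleftrightarrow>
     clifford_action g \<rho> \<and> (UNIV :: 'w set) \<noteq> {0} \<and>
     (\<forall>U. subspace U \<and> (\<forall>a \<in> carrier (clifford_algebra g). \<rho> a ` U \<subseteq> U)
            \<longrightarrow> U = {0} \<or> U = UNIV)"

definition graded_action ::
    "('v::real_vector \<Rightarrow> 'v \<Rightarrow> real) \<Rightarrow> ('v free_alg set \<Rightarrow> 'w::real_vector \<Rightarrow> 'w) \<Rightarrow>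
     'w set \<Rightarrow> 'w set \<Rightarrow> bool" where
  "graded_action g \<rho> W0 W1 \<longleftrightarrow>
     subspace W0 \<and> subspace W1 \<and> W0 \<inter> W1 = {0} \<and> (\<forall>x. \<exists>y \<in> W0. \<exists>z \<in> W1. x = y + z) \<and>
     (\<forall>a \<in> clifford_even g. \<rho> a ` W0 \<subseteq> W0 \<and> \<rho> a ` W1 \<subseteq> W1) \<and>
     (\<forall>a \<in> clifford_odd g. \<rho> a ` W0 \<subseteq> W1 \<and> \<rho> a ` W1 \<subseteq> W0)"

definition linear_into_End :: "('v::real_vector \<Rightarrow> 'w::real_vector \<Rightarrow> 'w) \<Rightarrow> bool" where
  "linear_into_End c \<longleftrightarrow> (\<forall>v. linear (c v)) \<and> (\<forall>x. linear (\<lambda>v. c v x))"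

definition extends_map ::
    "('v::real_vector \<Rightarrow> 'v \<Rightarrow> real) \<Rightarrow> ('v \<Rightarrow> 'w \<Rightarrow> 'w) \<Rightarrow> ('v free_alg set \<Rightarrow> 'w \<Rightarrow> 'w) \<Rightarrow> bool" where
  "extends_map g c \<rho> \<longleftrightarrow> (\<forall>v. \<rho> (clifford_class g (generator v)) = c v)"

text \<open>
  An algebra homomorphism out of the Clifford algebra is determined by its values on vectors,
  so the action in the next two definitions is unique on the carrier.
\<close>

definition generates_irreducible ::
    "nat \<Rightarrow> nat \<Rightarrow> ('v::real_vector \<Rightarrow> 'v \<Rightarrow> real) \<Rightarrow> ('v \<Rightarrow> 'w::real_vector \<Rightarrow> 'w) \<Rightarrow> bool" where
  "generates_irreducible r s g c \<longleftrightarrow>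
     has_signature g r s \<and> linear_into_End c \<and>
     (\<exists>\<rho>. clifford_action g \<rho> \<and> extends_map g c \<rho> \<and> irreducible_action g \<rho>)"

definition generates_graded_irreducible ::
    "nat \<Rightarrow> nat \<Rightarrow> ('v::real_vector \<Rightarrow> 'v \<Rightarrow> real) \<Rightarrow> ('v \<Rightarrow> 'w::real_vector \<Rightarrow> 'w) \<Rightarrow>
     'w set \<Rightarrow> 'w set \<Rightarrow> bool" where
  "generates_graded_irreducible r s g c W0 W1 \<longleftrightarrow>
     has_signature g r s \<and> linear_into_End c \<and>
     (\<exists>\<rho>. clifford_action g \<rho> \<and> extends_map g c \<rho> \<and> irreducible_action g \<rho> \<and>
          graded_action g \<rho> W0 W1)"


section \<open>The exterior algebra of a coordinate space\<close>

text \<open>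
  The exterior algebra of \<open>'k ^ 'n\<close> has a basis of blades indexed by the subsets \<open>I\<close> of \<open>'n\<close>:
  the exterior product of the standard basis vectors with index in \<open>I\<close>, in increasing order.
  A multivector is its family of coefficients in that basis. The exterior algebra of \<open>'k\<close> itself
  is the case where \<open>'n\<close> is the one-element type \<open>1\<close>.
\<close>

type_synonym ('k, 'n) multivector = "'k ^ ('n set)"

definition blade_sign :: "'n::linorder set \<Rightarrow> 'n set \<Rightarrow> 'k::comm_ring_1" where
  "blade_sign I J = (- 1) ^ card {(i, j). i \<in> I \<and> j \<in> J \<and> j < i}"

definition wedge ::
    "('k::field, 'n::{finite, linorder}) multivector \<Rightarrow> ('k, 'n) multivector \<Rightarrow> ('k, 'n) multivector" where
  "wedge \<alpha> \<beta> = (\<chi> K. \<Sum>I \<in> Pow K. blade_sign I (K - I) * (\<alpha> $ I) * (\<beta> $ (K - I)))"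

definition of_vector :: "'k::field ^ 'n::finite \<Rightarrow> ('k, 'n) multivector" where
  "of_vector x = (\<Sum>i \<in> UNIV. x $ i *s axis {i} 1)"

text \<open>
  Contraction by a dual vector \<open>\<omega>\<close>: deleting the factor with index \<open>i\<close> from a blade costs the sign
  of moving it to the front and multiplies by the value of \<open>\<omega>\<close> on the basis vector \<open>axis i 1\<close>.
\<close>

definition contraction ::
    "('k::field ^ 'n::{finite, linorder} \<Rightarrow> 'k) \<Rightarrow> ('k, 'n) multivector \<Rightarrow> ('k, 'n) multivector" where
  "contraction \<omega> \<alpha> =
     (\<chi> K. \<Sum>i \<in> - K. (- 1) ^ card {j \<in> K. j < i} * \<omega> (axis i 1) * (\<alpha> $ insert i K))"

definition degree_sign :: "('k::field, 'n::finite) multivector \<Rightarrow> ('k, 'n) multivector" where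
  "degree_sign \<alpha> = (\<chi> I. (- 1) ^ card I * (\<alpha> $ I))"

definition even_multivectors :: "('k::field, 'n::finite) multivector set" where
  "even_multivectors = {\<alpha>. \<forall>I. odd (card I) \<longrightarrow> \<alpha> $ I = 0}"

definition odd_multivectors :: "('k::field, 'n::finite) multivector set" where
  "odd_multivectors = {\<alpha>. \<forall>I. even (card I) \<longrightarrow> \<alpha> $ I = 0}"

definition hermitian_dual :: "complex ^ 'n::finite \<Rightarrow> complex ^ 'n \<Rightarrow> complex" where
  "hermitian_dual f z = (\<Sum>i \<in> UNIV. cnj (f $ i) * (z $ i))"


section \<open>Quaternions\<close>

text \<open>The vector with components \<open>a, b, c, d\<close> is the quaternion $a + b i + c j + d k$.\<close>

type_synonym quaternion = "real ^ 4"

definition qmult :: "quaternion \<Rightarrow> quaternion \<Rightarrow> quaternion" where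
  "qmult p q = vector
     [p$1 * q$1 - p$2 * q$2 - p$3 * q$3 - p$4 * q$4,
      p$1 * q$2 + p$2 * q$1 + p$3 * q$4 - p$4 * q$3,
      p$1 * q$3 - p$2 * q$4 + p$3 * q$1 + p$4 * q$2,
      p$1 * q$4 + p$2 * q$3 - p$3 * q$2 + p$4 * q$1]"

definition qcnj :: "quaternion \<Rightarrow> quaternion" where
  "qcnj q = vector [q$1, - q$2, - q$3, - q$4]"

text \<open>
  The exterior algebra of the bimodule of quaternions over itself is identified with its parts of
  degree 0 and 1: since \<open>1 \<otimes> 1\<close> is a relator, nothing is left in degree 2 and above.
\<close>

type_synonym quaternionic_multivector = "quaternion \<times> quaternion"

definition qexterior_left :: "quaternion \<Rightarrow> quaternionic_multivector \<Rightarrow> quaternionic_multivector" where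
  "qexterior_left q = (\<lambda>(a, b). (0, qmult q a))"

definition qcontraction_left :: "quaternion \<Rightarrow> quaternionic_multivector \<Rightarrow> quaternionic_multivector" where
  "qcontraction_left q = (\<lambda>(a, b). (qmult (qcnj q) b, 0))"

definition right_quaternion_linear :: "(quaternionic_multivector \<Rightarrow> quaternionic_multivector) \<Rightarrow> bool" where
  "right_quaternion_linear f \<longleftrightarrow>
     (\<forall>x y. f (x + y) = f x + f y) \<and>
     (\<forall>a b h. f (qmult a h, qmult b h) = (qmult (fst (f (a, b))) h, qmult (snd (f (a, b))) h))"


section \<open>The Clifford maps\<close>

definition c10 :: "real \<Rightarrow> real \<Rightarrow> real" where
  "c10 x y = x * y"

definition is_c20 ::
    "real ^ 2 \<Rightarrow> real ^ 2 \<Rightarrow> real ^ 1 \<Rightarrow>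
     (real ^ 2 \<Rightarrow> (real, 1) multivector \<Rightarrow> (real, 1) multivector) \<Rightarrow> bool" where
  "is_c20 e1 e2 f1 c \<longleftrightarrow>
     linear_into_End c \<and>
     c e1 = (\<lambda>\<alpha>. wedge (of_vector f1) \<alpha> + contraction (\<lambda>y. f1 \<bullet> y) \<alpha>) \<and>
     c e2 = degree_sign"

definition is_c30 ::
    "real ^ 3 \<Rightarrow> real ^ 3 \<Rightarrow> real ^ 3 \<Rightarrow> complex ^ 1 \<Rightarrow>
     (real ^ 3 \<Rightarrow> (complex, 1) multivector \<Rightarrow> (complex, 1) multivector) \<Rightarrow> bool" where
  "is_c30 e1 e2 e3 f1 c \<longleftrightarrow>
     linear_into_End c \<and>
     c e1 = (\<lambda>\<alpha>. wedge (of_vector f1) \<alpha> + contraction (hermitian_dual f1) \<alpha>) \<and>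
     c e2 = (\<lambda>\<alpha>. \<i> *s wedge (of_vector f1) \<alpha> - \<i> *s contraction (hermitian_dual f1) \<alpha>) \<and>
     c e3 = degree_sign"

definition c40 :: "quaternion \<Rightarrow> quaternionic_multivector \<Rightarrow> quaternionic_multivector" where
  "c40 q x = qexterior_left q x + qcontraction_left q x"

text \<open>The dual space of \<open>real ^ 'n\<close> is the type \<open>(real ^ 'n) \<Rightarrow>\<^sub>L real\<close>: all functionals are bounded.\<close>

type_synonym 'n split_space = "(real ^ 'n) \<times> ((real ^ 'n) \<Rightarrow>\<^sub>L real)"

definition cii ::
    "'n::{finite, linorder} split_space \<Rightarrow>
     (real, 'n) multivector \<Rightarrow> (real, 'n) multivector" where
  "cii = (\<lambda>(x, \<omega>) \<alpha>. wedge (of_vector x) \<alpha> - contraction (blinfun_apply \<omega>) \<alpha>)"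

definition pairing_metric ::
    "'n::finite split_space \<Rightarrow> 'n::finite split_space \<Rightarrow> real" where
  "pairing_metric = (\<lambda>(x, \<omega>) (y, \<tau>). blinfun_apply \<omega> y + blinfun_apply \<tau> x)"

text \<open>
  Since \<open>cii v (cii v \<alpha>) = - \<omega> x \<alpha>\<close> for \<open>v = (x, \<omega>)\<close>, the map \<open>cii\<close> satisfies
  \<open>v w + w v = - pairing_metric v w\<close>. The Clifford relations have a factor 2 on the right, hence
  \<open>cii\<close> is a Clifford map for half of the pairing metric, and \<open>sqrt 2\<close> times \<open>cii\<close> is one for the
  pairing metric itself.
\<close>

definition half_pairing_metric ::
    "'n::finite split_space \<Rightarrow> 'n::finite split_space \<Rightarrow> real" where
  "half_pairing_metric v w = pairing_metric v w / 2"

end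

theory Submission
  imports Defs
begin

text \<open>
  A linear map \<open>c\<close> from a quadratic space into the endomorphisms of \<open>W\<close> that satisfies
  \<open>c v c w + c w c v = - 2 g(v, w)\<close> extends to an action of the Clifford algebra: evaluating words in
  the generators as compositions of operators gives a homomorphism on the free algebra, and its kernel
  is an ideal containing the relators (\<open>clifford_extension_action\<close>). A subspace that is stable under
  the action is stable under each \<open>c v\<close>. So every part of the theorem reduces to two checks: the
  Clifford relation for \<open>c\<close>, and that a nonzero subspace stable under all \<open>c v\<close> is everything.

  On exterior algebras both checks come from the operators \<open>raise i\<close> and \<open>lower i\<close>, exterior
  multiplication by the \<open>i\<close>-th basis vector and contraction by its dual, which satisfy the canonical
  anticommutation relations (\<open>raise_raise\<close>, \<open>lower_lower\<close>, \<open>raise_lower\<close>). These give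
  \<open>wedge x \<circ> contraction \<omega> + contraction \<omega> \<circ> wedge x = \<omega> x\<close>, hence the Clifford
  relations. For irreducibility, \<open>raise i \<circ> lower i\<close> and \<open>lower i \<circ> raise i\<close> are the complementary
  projections onto the blades that contain \<open>i\<close> and those that do not. Composing them over all \<open>i\<close> cuts
  a nonzero multivector down to a multiple of one blade, and raising and lowering reach all others from
  it (\<open>exterior_irreducible\<close>).

  It remains to recover these operators from the Clifford action. In the split case they are values of
  \<open>cii\<close> itself, up to sign. On the exterior algebra of a line, the grading operator \<open>\<epsilon>\<close> is in the image
  of the action and separates \<open>wedge f\<close> from \<open>contraction f\<close>, since \<open>wedge f \<circ> \<epsilon> = wedge f\<close> and
  \<open>contraction f \<circ> \<epsilon> = - contraction f\<close>; on complex multivectors the product of the three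
  generators is multiplication by \<open>\<i>\<close>, so stable real subspaces are complex. For the quaternions,
  the volume element acts as the grading, so a stable subspace contains the two components of its
  elements, and the division property of the quaternions does the rest.
\<close>

section \<open>The universal property of Clifford algebras\<close>

definition evaluate :: "('v \<Rightarrow> 'w \<Rightarrow> 'w) \<Rightarrow> 'v free_alg \<Rightarrow> 'w::real_vector \<Rightarrow> 'w" where
  "evaluate c t x = (\<Sum>u \<in> Poly_Mapping.keys t. Poly_Mapping.lookup t u *\<^sub>R foldr c (letters u) x)"

lemma evaluate_superset:
  assumes "finite S" "Poly_Mapping.keys t \<subseteq> S"
  shows "evaluate c t x = (\<Sum>u \<in> S. Poly_Mapping.lookup t u *\<^sub>R foldr c (letters u) x)"
  unfolding evaluate_def
  by (rule sum.mono_neutral_left) (use assms in \<open>auto simp: in_keys_iff\<close>)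

lemma evaluate_add: "evaluate c (s + t) x = evaluate c s x + evaluate c t x"
proof -
  let ?S = "Poly_Mapping.keys s \<union> Poly_Mapping.keys t"
  have "Poly_Mapping.keys (s + t) \<subseteq> ?S" by (rule Poly_Mapping.keys_add)
  then show ?thesis
    by (simp add: evaluate_superset[of ?S] lookup_add scaleR_add_left sum.distrib)
qed

lemma evaluate_single:
  "evaluate c (Poly_Mapping.single u r) x = r *\<^sub>R foldr c (letters u) x"
  by (simp add: evaluate_def)

lemma evaluate_zero: "evaluate c 0 x = 0"
  by (simp add: evaluate_def)

lemma evaluate_uminus: "evaluate c (- t) x = - evaluate c t x"
  by (simp add: evaluate_def sum_negf)

lemma evaluate_diff: "evaluate c (s - t) x = evaluate c s x - evaluate c t x"
  using evaluate_add[of c s "- t"] by (simp add: evaluate_uminus)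

lemma evaluate_generator: "evaluate c (generator v) x = c v x"
  by (simp add: generator_def evaluate_single)

lemma evaluate_scalar: "evaluate c (scalar r) x = r *\<^sub>R x"
  by (simp add: scalar_def evaluate_single zero_free_monoid_def)

lemma evaluate_one: "evaluate c 1 x = x"
  using evaluate_scalar[of c 1 x] by (simp add: scalar_def)

lemma linear_foldr:
  assumes "\<And>v. linear (c v)"
  shows "linear (foldr c vs)"
proof (induction vs)
  case Nil
  then show ?case by (simp add: linear_ident id_def)
next
  case (Cons v vs)
  then show ?case using linear_compose[OF Cons assms[of v]] by (simp add: comp_def)
qed

lemma linear_evaluate:
  assumes "\<And>v. linear (c v)"
  shows "linear (evaluate c t)"
  unfolding evaluate_def
  by (intro linear_compose_sum ballI linear_compose_scale_right linear_foldr assms)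

text \<open>
  Additive statements about the free algebra need to be checked on scalar multiples of single words
  only; this turns the multiplicativity of \<open>evaluate\<close> into the behaviour of \<open>foldr\<close> on concatenations.
\<close>
lemma free_alg_induct [case_names single add]:
  fixes P :: "'v free_alg \<Rightarrow> bool"
  assumes single: "\<And>u r. P (Poly_Mapping.single u r)"
    and add: "\<And>s t. P s \<Longrightarrow> P t \<Longrightarrow> P (s + t)"
  shows "P t"
proof (induction t rule: Poly_Mapping.update_induct)
  case const
  show ?case using single[of undefined 0] by simp
next
  case (update f a b)
  have "Poly_Mapping.update a b f = f + Poly_Mapping.single a b"
    using update.hyps(1)
    by (intro poly_mapping_eqI) (auto simp: lookup_update lookup_add lookup_single in_keys_iff when_def)
  then show ?case using add[OF update.IH single] by simp
qed

lemma evaluate_mult: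
  assumes "\<And>v. linear (c v)"
  shows "evaluate c (s * t) x = evaluate c s (evaluate c t x)"
proof (induction s rule: free_alg_induct)
  case (single u r)
  show ?case
  proof (induction t rule: free_alg_induct)
    case (single w q)
    show ?case
      by (simp add: mult_single evaluate_single plus_free_monoid_def
          linear_scale[OF linear_foldr[of c, OF assms]])
  next
    case (add t1 t2)
    then show ?case
      by (simp add: distrib_left evaluate_add linear_add[OF linear_evaluate[of c, OF assms]])
  qed
next
  case (add s1 s2)
  then show ?case by (simp add: distrib_right evaluate_add)
qed

lemma ring_free_algebra: "ring (free_algebra :: 'v free_alg ring)"
proof (intro ringI abelian_groupI monoidI)
  fix x :: "'v free_alg"
  show "\<exists>y\<in>carrier free_algebra. y \<oplus>\<^bsub>free_algebra\<^esub> x = \<zero>\<^bsub>free_algebra\<^esub>"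
    by (rule bexI[of _ "- x"]) (simp_all add: free_algebra_def)
qed (simp_all add: free_algebra_def algebra_simps)

definition clifford_map :: "('v::real_vector \<Rightarrow> 'v \<Rightarrow> real) \<Rightarrow> ('v \<Rightarrow> 'w::real_vector \<Rightarrow> 'w) \<Rightarrow> bool" where
  "clifford_map g c \<longleftrightarrow>
     linear_into_End c \<and> (\<forall>v w x. c v (c w x) + c w (c v x) = - (2 * g v w) *\<^sub>R x)"

lemma evaluate_kernel_ideal:
  assumes "\<And>v. linear (c v)"
  shows "ideal {t. evaluate c t = (\<lambda>x. 0)} free_algebra"
proof -
  interpret ring "free_algebra :: 'a free_alg ring" by (rule ring_free_algebra)
  show ?thesis
  proof (rule idealI)
    have "a_inv free_algebra a = - a" for a :: "'a free_alg"
      by (rule minus_equality) (simp_all add: free_algebra_def)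
    then show "subgroup {t. evaluate c t = (\<lambda>x. 0)} (add_monoid free_algebra)"
      by (intro add.subgroupI)
         (auto simp: fun_eq_iff free_algebra_def evaluate_add evaluate_uminus evaluate_zero
           intro: exI[of _ 0])
  qed (use ring_free_algebra linear_0[OF linear_evaluate[of c, OF assms]] in
        \<open>auto simp: free_algebra_def evaluate_mult[of c, OF assms]\<close>)
qed

text \<open>
  The Clifford ideal is the least ideal containing the relators, so it is enough that evaluation kills
  these: the first two families by linearity of \<open>c\<close> in the vector, the third by the Clifford relation.
\<close>
lemma clifford_ideal_vanishes:
  assumes c: "clifford_map g c" and t: "t \<in> clifford_ideal g"
  shows "evaluate c t x = 0"
proof -
  have lin: "linear (c v)" "linear (\<lambda>v. c v x)" for v x
    using c by (auto simp: clifford_map_def linear_into_End_def)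
  have "clifford_relators g \<subseteq> {t. evaluate c t = (\<lambda>x. 0)}"
    using c linear_add[OF lin(2)] linear_scale[OF lin(2)]
    by (auto simp: clifford_relators_def fun_eq_iff evaluate_add evaluate_diff evaluate_generator
        evaluate_scalar evaluate_mult[of c, OF lin(1)] clifford_map_def)
  then have "clifford_ideal g \<subseteq> {t. evaluate c t = (\<lambda>x. 0)}"
    unfolding clifford_ideal_def
    by (intro ring.genideal_minimal ring_free_algebra evaluate_kernel_ideal lin)
  then show ?thesis using t by (auto simp: fun_eq_iff)
qed

lemma clifford_ideal_ideal: "ideal (clifford_ideal g) free_algebra"
  unfolding clifford_ideal_def
  by (rule ring.genideal_ideal[OF ring_free_algebra]) (simp add: free_algebra_def)

lemma clifford_class_eq: "clifford_class g t = {s + t | s. s \<in> clifford_ideal g}"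
  by (auto simp: clifford_class_def a_r_coset_def r_coset_def free_algebra_def)

text \<open>
  The value on a coset is read off from an arbitrary representative; \<open>clifford_extension_class\<close> shows
  that the choice does not matter.
\<close>
definition clifford_extension ::
  "('v::real_vector \<Rightarrow> 'w \<Rightarrow> 'w) \<Rightarrow> 'v free_alg set \<Rightarrow> 'w::real_vector \<Rightarrow> 'w" where
  "clifford_extension c S = evaluate c (SOME t. t \<in> S)"

lemma clifford_extension_class:
  assumes "clifford_map g c"
  shows "clifford_extension c (clifford_class g t) = evaluate c t"
proof -
  interpret ideal "clifford_ideal g" free_algebra by (rule clifford_ideal_ideal)
  have "t \<in> clifford_class g t"
    using a_rcos_self[of t] by (simp add: clifford_class_def free_algebra_def)
  then have "(SOME s. s \<in> clifford_class g t) \<in> clifford_class g t" by (rule someI)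
  then obtain s where "s \<in> clifford_ideal g" "(SOME s. s \<in> clifford_class g t) = s + t"
    by (auto simp: clifford_class_eq)
  then show ?thesis
    using clifford_ideal_vanishes[OF assms]
    by (simp add: clifford_extension_def fun_eq_iff evaluate_add)
qed

lemma clifford_algebra_carrier:
  "carrier (clifford_algebra g) = range (clifford_class g)"
  by (auto simp: clifford_algebra_def FactRing_def A_RCOSETS_defs clifford_class_def
      a_r_coset_def r_coset_def free_algebra_def)

lemma clifford_extension_action:
  assumes c: "clifford_map g c"
  shows "clifford_action g (clifford_extension c)"
proof -
  interpret ideal "clifford_ideal g" free_algebra by (rule clifford_ideal_ideal)
  have lin: "linear (c v)" for v
    using c by (auto simp: clifford_map_def linear_into_End_def)
  note ext = clifford_extension_class[OF c]
  have car: "t \<in> carrier free_algebra" for t :: "'a free_alg"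
    by (simp add: free_algebra_def)
  have mult: "clifford_class g s \<otimes>\<^bsub>clifford_algebra g\<^esub> clifford_class g t = clifford_class g (s * t)" for s t
    using rcoset_mult_add[OF car car, of s t]
    by (simp add: clifford_algebra_def FactRing_def clifford_class_def) (simp add: free_algebra_def)
  have add: "clifford_class g s \<oplus>\<^bsub>clifford_algebra g\<^esub> clifford_class g t = clifford_class g (s + t)" for s t
    using a_rcos_sum[OF car car, of s t]
    by (simp add: clifford_algebra_def FactRing_def clifford_class_def) (simp add: free_algebra_def)
  have one: "\<one>\<^bsub>clifford_algebra g\<^esub> = clifford_class g 1"
    by (simp add: clifford_algebra_def FactRing_def clifford_class_def) (simp add: free_algebra_def)
  have "clifford_extension c \<in> ring_hom (clifford_algebra g) endomorphism_ring"
    by (rule ring_hom_memI)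
       (auto simp: clifford_algebra_carrier mult add one ext endomorphism_ring_def
         linear_evaluate[of c, OF lin] evaluate_mult[of c, OF lin] evaluate_add evaluate_one)
  then show ?thesis
    by (simp add: clifford_action_def ext evaluate_scalar fun_eq_iff)
qed

lemma clifford_extension_extends:
  assumes "clifford_map g c"
  shows "extends_map g c (clifford_extension c)"
  by (simp add: extends_map_def clifford_extension_class[OF assms] evaluate_generator fun_eq_iff)

lemma clifford_extension_irreducible:
  fixes c :: "'v::real_vector \<Rightarrow> 'w::real_vector \<Rightarrow> 'w"
  assumes c: "clifford_map g c" and "(UNIV :: 'w set) \<noteq> {0}"
    and irr: "\<And>U. subspace U \<Longrightarrow> (\<And>v x. x \<in> U \<Longrightarrow> c v x \<in> U) \<Longrightarrow> U \<noteq> {0} \<Longrightarrow> U = UNIV"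
  shows "irreducible_action g (clifford_extension c)"
proof -
  have "U = {0} \<or> U = UNIV"
    if U: "subspace U" "\<forall>a \<in> carrier (clifford_algebra g). clifford_extension c a ` U \<subseteq> U" for U
  proof -
    have "c v x \<in> U" if "x \<in> U" for v x
    proof -
      have "clifford_extension c (clifford_class g (generator v)) ` U \<subseteq> U"
        using U(2) by (simp add: clifford_algebra_carrier)
      then show ?thesis
        using that clifford_extension_extends[OF c] by (auto simp: extends_map_def)
    qed
    then show ?thesis using irr[OF U(1)] by blast
  qed
  then show ?thesis
    using clifford_extension_action[OF c] assms(2) by (auto simp: irreducible_action_def)
qed

lemma generates_irreducibleI:
  fixes c :: "'v::real_vector \<Rightarrow> 'w::real_vector \<Rightarrow> 'w"
  assumes "has_signature g r s" and c: "clifford_map g c" and "(UNIV :: 'w set) \<noteq> {0}"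
    and "\<And>U. subspace U \<Longrightarrow> (\<And>v x. x \<in> U \<Longrightarrow> c v x \<in> U) \<Longrightarrow> U \<noteq> {0} \<Longrightarrow> U = UNIV"
  shows "generates_irreducible r s g c"
  using assms(1) c clifford_extension_extends[OF c] clifford_extension_action[OF c]
    clifford_extension_irreducible[OF c assms(3,4)]
  by (auto simp: generates_irreducible_def clifford_map_def)

text \<open>
  Each letter of a word exchanges \<open>W0\<close> and \<open>W1\<close>, so a word acts with the parity of its length.
\<close>
lemma generates_graded_irreducibleI:
  fixes c :: "'v::real_vector \<Rightarrow> 'w::real_vector \<Rightarrow> 'w"
  assumes "has_signature g r s" and c: "clifford_map g c" and "(UNIV :: 'w set) \<noteq> {0}"
    and "\<And>U. subspace U \<Longrightarrow> (\<And>v x. x \<in> U \<Longrightarrow> c v x \<in> U) \<Longrightarrow> U \<noteq> {0} \<Longrightarrow> U = UNIV"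
    and W: "subspace W0" "subspace W1" "W0 \<inter> W1 = {0}" "\<And>x. \<exists>y \<in> W0. \<exists>z \<in> W1. x = y + z"
    and swap: "\<And>v x. x \<in> W0 \<Longrightarrow> c v x \<in> W1" "\<And>v x. x \<in> W1 \<Longrightarrow> c v x \<in> W0"
  shows "generates_graded_irreducible r s g c W0 W1"
proof -
  have word0: "(even (length vs) \<longrightarrow> foldr c vs x \<in> W0) \<and> (odd (length vs) \<longrightarrow> foldr c vs x \<in> W1)"
    if "x \<in> W0" for vs x
    using that swap by (induction vs) auto
  have word1: "(even (length vs) \<longrightarrow> foldr c vs x \<in> W1) \<and> (odd (length vs) \<longrightarrow> foldr c vs x \<in> W0)"
    if "x \<in> W1" for vs x
    using that swap by (induction vs) auto
  have evaluate_mem: "evaluate c t x \<in> W"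
    if "subspace W" "\<forall>u \<in> Poly_Mapping.keys t. foldr c (letters u) x \<in> W" for t x W
    unfolding evaluate_def using that by (intro subspace_sum subspace_scale) auto
  have "graded_action g (clifford_extension c) W0 W1"
    unfolding graded_action_def
  proof (intro conjI allI ballI)
    fix a assume "a \<in> clifford_even g"
    then obtain t where t: "clifford_extension c a = evaluate c t"
      "\<forall>u \<in> Poly_Mapping.keys t. even (length (letters u))"
      by (auto simp: clifford_even_def clifford_extension_class[OF c])
    show "clifford_extension c a ` W0 \<subseteq> W0" "clifford_extension c a ` W1 \<subseteq> W1"
      using t(2) by (auto simp: t(1) word0 word1 intro!: evaluate_mem W(1,2))
  next
    fix a assume "a \<in> clifford_odd g"
    then obtain t where t: "clifford_extension c a = evaluate c t"
      "\<forall>u \<in> Poly_Mapping.keys t. odd (length (letters u))"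
      by (auto simp: clifford_odd_def clifford_extension_class[OF c])
    show "clifford_extension c a ` W0 \<subseteq> W1" "clifford_extension c a ` W1 \<subseteq> W0"
      using t(2) by (auto simp: t(1) word0 word1 intro!: evaluate_mem W(1,2))
  qed (use W in auto)
  then show ?thesis
    using assms(1) c clifford_extension_extends[OF c] clifford_extension_action[OF c]
      clifford_extension_irreducible[OF c assms(3,4)]
    by (auto simp: generates_graded_irreducible_def clifford_map_def)
qed

text \<open>
  Both sides of the Clifford relation are bilinear in the two vectors.
\<close>
lemma clifford_map_on_basis:
  fixes g :: "'v::real_vector \<Rightarrow> 'v \<Rightarrow> real"
  assumes c: "linear_into_End c" and g: "bilinear g" and B: "span B = UNIV"
    and rel: "\<And>a b x. a \<in> B \<Longrightarrow> b \<in> B \<Longrightarrow> c a (c b x) + c b (c a x) = - (2 * g a b) *\<^sub>R x"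
  shows "clifford_map g c"
proof -
  have "c v (c w x) + c w (c v x) = - (2 * g v w) *\<^sub>R x" for v w x
  proof -
    have lin: "linear (c v)" "linear (\<lambda>v. c v x)" for v x
      using c by (auto simp: linear_into_End_def)
    show ?thesis
    proof (rule bilinear_eq[of "\<lambda>v w. c v (c w x) + c w (c v x)" "\<lambda>v w. - (2 * g v w) *\<^sub>R x" UNIV B UNIV B])
      show "bilinear (\<lambda>v w. c v (c w x) + c w (c v x))"
        using lin by (auto simp: bilinear_def intro!: linear_compose_add
            linear_compose[of "\<lambda>v. c v _" "c _", unfolded comp_def])
      show "bilinear (\<lambda>v w. - (2 * g v w) *\<^sub>R x)"
        using g by (auto simp: bilinear_def linear_iff scaleR_add_left algebra_simps)
    qed (use B rel in auto)
  qed
  then show ?thesis using c by (simp add: clifford_map_def)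
qed

section \<open>Definite quadratic forms and orthonormal bases\<close>

lemma bilinear_neg_inner: "bilinear (neg_inner :: 'v::real_inner \<Rightarrow> _)"
  by (auto simp: neg_inner_def bilinear_def linear_iff algebra_simps)

lemma has_signature_neg_inner:
  "has_signature (neg_inner :: 'v::euclidean_space \<Rightarrow> _) DIM('v) 0"
  unfolding has_signature_def
proof (intro conjI allI exI)
  show "linear (neg_inner v)" for v :: 'v
    using bilinear_neg_inner by (auto simp: bilinear_def)
  show "\<forall>v \<in> Basis \<union> {}. \<forall>w \<in> Basis \<union> {}.
      neg_inner (v::'v) w = (if v \<noteq> w then 0 else if v \<in> Basis then - 1 else 1)"
    by (auto simp: neg_inner_def inner_Basis)
qed (auto simp: neg_inner_def inner_commute independent_Basis)

lemma orthonormal_span: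
  fixes B :: "'v::euclidean_space set"
  assumes B: "\<And>a b. a \<in> B \<Longrightarrow> b \<in> B \<Longrightarrow> a \<bullet> b = (if a = b then 1 else 0)" and "card B = DIM('v)"
  shows "span B = UNIV"
proof -
  have "independent B"
    by (rule pairwise_orthogonal_independent) (use B in \<open>force simp: pairwise_def orthogonal_def\<close>)+
  then show ?thesis
    using card_ge_dim_independent[of B UNIV] assms(2) by auto
qed

text \<open>
  An orthonormal basis makes the coordinates of \<open>v\<close> available as \<open>v \<bullet> b\<close>, which gives the linear
  extension by an explicit formula.
\<close>
lemma ex1_linear_into_End:
  fixes T :: "'v::euclidean_space \<Rightarrow> 'w::real_vector \<Rightarrow> 'w"
  assumes B: "\<And>a b. a \<in> B \<Longrightarrow> b \<in> B \<Longrightarrow> a \<bullet> b = (if a = b then 1 else 0)" and "card B = DIM('v)"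
    and T: "\<And>b. b \<in> B \<Longrightarrow> linear (T b)"
  shows "\<exists>!c. linear_into_End c \<and> (\<forall>b \<in> B. c b = T b)"
proof (rule ex1I)
  have fin: "finite B" using assms(2) by (metis DIM_positive card.infinite less_numeral_extra(3))
  let ?c = "\<lambda>v x. \<Sum>b\<in>B. (v \<bullet> b) *\<^sub>R T b x"
  have "linear_into_End ?c"
    unfolding linear_into_End_def
  proof (intro conjI allI)
    show "linear (?c v)" for v
      by (intro linear_compose_sum ballI linear_compose_scale_right T)
    show "linear (\<lambda>v. ?c v x)" for x
      by (auto simp: linear_iff inner_add_left scaleR_add_left sum.distrib scaleR_sum_right)
  qed
  moreover have "?c a = T a" if "a \<in> B" for a
  proof
    fix x
    have "?c a x = (\<Sum>b\<in>B. if b = a then T a x else 0)"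
      using that by (intro sum.cong) (auto simp: B)
    then show "?c a x = T a x" using that fin by simp
  qed
  ultimately show "linear_into_End ?c \<and> (\<forall>b \<in> B. ?c b = T b)" by blast
  fix d assume d: "linear_into_End d \<and> (\<forall>b \<in> B. d b = T b)"
  show "d = ?c"
  proof (intro ext)
    fix v x
    show "d v x = ?c v x"
      by (rule linear_eq_on[of "\<lambda>v. d v x" "\<lambda>v. ?c v x" v B])
         (use d \<open>linear_into_End ?c\<close> \<open>\<And>a. a \<in> B \<Longrightarrow> ?c a = T a\<close> orthonormal_span[OF assms(1,2)]
          in \<open>auto simp: linear_into_End_def fun_eq_iff\<close>)
  qed
qed

lemma neg_inner_orthonormal:
  "neg_inner v v = - 1 \<longleftrightarrow> v \<bullet> v = 1" "neg_inner v w = 0 \<longleftrightarrow> v \<bullet> w = 0"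
  by (auto simp: neg_inner_def)

section \<open>Exterior multiplication and contraction\<close>

text \<open>
  The sign of moving the factor with index \<open>i\<close> to the front of the blade of \<open>K\<close>, or from the front to
  its place.
\<close>
definition moving_sign :: "'n::linorder \<Rightarrow> 'n set \<Rightarrow> 'k::comm_ring_1" where
  "moving_sign i K = (- 1) ^ card {j \<in> K. j < i}"

text \<open>
  Creation operator: exterior multiplication by the basis vector \<open>axis i 1\<close> from the left.
\<close>
definition raise :: "'n::{finite, linorder} \<Rightarrow> ('k::field, 'n) multivector \<Rightarrow> ('k, 'n) multivector" where
  "raise i \<alpha> = (\<chi> K. if i \<in> K then moving_sign i K * \<alpha> $ (K - {i}) else 0)"

text \<open>
  Annihilation operator: contraction by the \<open>i\<close>-th coordinate functional.
\<close>
definition lower :: "'n::{finite, linorder} \<Rightarrow> ('k::field, 'n) multivector \<Rightarrow> ('k, 'n) multivector" where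
  "lower i \<alpha> = (\<chi> K. if i \<in> K then 0 else moving_sign i K * \<alpha> $ insert i K)"

lemma moving_sign_square [simp]: "moving_sign i K * moving_sign i K = (1 :: 'k::comm_ring_1)"
  by (simp add: moving_sign_def flip: power_add)

lemma moving_sign_cancel [simp]: "moving_sign i K * (moving_sign i K * x) = (x :: 'k::comm_ring_1)"
  by (simp flip: mult.assoc)

lemma moving_sign_same [simp]:
  "moving_sign i (K - {i}) = moving_sign i K" "moving_sign i (insert i K) = moving_sign i K"
proof -
  have "{j \<in> K - {i}. j < i} = {j \<in> K. j < i}" "{j \<in> insert i K. j < i} = {j \<in> K. j < i}"
    by auto
  then show "moving_sign i (K - {i}) = moving_sign i K" "moving_sign i (insert i K) = moving_sign i K"
    by (simp_all only: moving_sign_def)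
qed

lemma moving_sign_insert:
  fixes K :: "'n::{finite, linorder} set"
  assumes "j \<notin> K"
  shows "moving_sign i (insert j K) = (if j < i then - moving_sign i K else moving_sign i K)"
proof -
  have "{l \<in> insert j K. l < i} = (if j < i then insert j {l \<in> K. l < i} else {l \<in> K. l < i})"
    by auto
  then show ?thesis using assms by (simp add: moving_sign_def)
qed

lemma moving_sign_remove:
  fixes K :: "'n::{finite, linorder} set"
  assumes "j \<in> K"
  shows "moving_sign i (K - {j}) = (if j < i then - moving_sign i K else moving_sign i K)"
proof -
  obtain L where "K = insert j L" "j \<notin> L" using assms by (meson mk_disjoint_insert)
  then show ?thesis by (simp add: moving_sign_insert)
qed

lemma linear_raise: "Vector_Spaces.linear (*s) (*s) (raise i)"
  by unfold_locales (auto simp: raise_def vec_eq_iff algebra_simps)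

lemma linear_lower: "Vector_Spaces.linear (*s) (*s) (lower i)"
  by unfold_locales (auto simp: lower_def vec_eq_iff algebra_simps)

text \<open>
  For \<open>i \<noteq> j\<close>, the larger of the two indices passes the smaller one in exactly one of the two orders
  of application. This accounts for the relative sign here and in the next two lemmas.
\<close>
lemma raise_raise:
  fixes \<alpha> :: "('k::field, 'n::{finite, linorder}) multivector"
  shows "raise i (raise j \<alpha>) + raise j (raise i \<alpha>) = 0"
proof (cases "i = j")
  case False
  show ?thesis
  proof (subst vec_eq_iff, rule allI)
    fix K
    have comm: "K - {j} - {i} = K - {i} - {j}" by auto
    have "moving_sign j K * moving_sign i (K - {j}) = - (moving_sign i K * moving_sign j (K - {i}) :: 'k)"
      if "i \<in> K" "j \<in> K"
      using that False by (cases i j rule: linorder_cases) (auto simp: moving_sign_remove mult.commute)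
    then show "(raise i (raise j \<alpha>) + raise j (raise i \<alpha>)) $ K = 0 $ K"
      using False by (auto simp: raise_def comm simp flip: mult.assoc)
  qed
qed (simp add: raise_def vec_eq_iff)

lemma lower_lower:
  fixes \<alpha> :: "('k::field, 'n::{finite, linorder}) multivector"
  shows "lower i (lower j \<alpha>) + lower j (lower i \<alpha>) = 0"
proof (cases "i = j")
  case False
  show ?thesis
  proof (subst vec_eq_iff, rule allI)
    fix K
    have comm: "insert j (insert i K) = insert i (insert j K)" by auto
    have "moving_sign j K * moving_sign i (insert j K) = - (moving_sign i K * moving_sign j (insert i K) :: 'k)"
      if "i \<notin> K" "j \<notin> K"
      using that False by (cases i j rule: linorder_cases) (auto simp: moving_sign_insert mult.commute)
    then show "(lower i (lower j \<alpha>) + lower j (lower i \<alpha>)) $ K = 0 $ K"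
      using False by (auto simp: lower_def comm simp flip: mult.assoc)
  qed
qed (simp add: lower_def vec_eq_iff)

lemma raise_lower:
  fixes \<alpha> :: "('k::field, 'n::{finite, linorder}) multivector"
  shows "raise i (lower j \<alpha>) + lower j (raise i \<alpha>) = (if i = j then \<alpha> else 0)"
proof (cases "i = j")
  case True
  then show ?thesis
    by (auto simp: raise_def lower_def vec_eq_iff insert_absorb)
next
  case False
  have "(raise i (lower j \<alpha>) + lower j (raise i \<alpha>)) $ K = 0 $ K" for K
  proof -
    have comm: "insert j K - {i} = insert j (K - {i})" using False by auto
    have "moving_sign j K * moving_sign i (insert j K) = - (moving_sign i K * moving_sign j (K - {i}) :: 'k)"
      if "i \<in> K" "j \<notin> K"
      using that False
      by (cases i j rule: linorder_cases) (auto simp: moving_sign_insert moving_sign_remove mult.commute)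
    then show ?thesis
      using False by (auto simp: raise_def lower_def comm simp flip: mult.assoc)
  qed
  then show ?thesis using False by (simp add: vec_eq_iff)
qed

lemma anticommutator_sum:
  fixes A B :: "'n::finite \<Rightarrow> 'k::field ^ 'm \<Rightarrow> 'k ^ 'm"
  assumes A: "\<And>i. Vector_Spaces.linear (*s) (*s) (A i)"
    and B: "\<And>j. Vector_Spaces.linear (*s) (*s) (B j)"
    and D: "\<And>i j. A i (B j \<alpha>) + B j (A i \<alpha>) = D i j"
  shows "(\<Sum>i\<in>UNIV. a i *s A i (\<Sum>j\<in>UNIV. b j *s B j \<alpha>)) +
         (\<Sum>j\<in>UNIV. b j *s B j (\<Sum>i\<in>UNIV. a i *s A i \<alpha>)) =
         (\<Sum>i\<in>UNIV. \<Sum>j\<in>UNIV. (a i * b j) *s D i j)"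
proof -
  have "(\<Sum>i\<in>UNIV. a i *s A i (\<Sum>j\<in>UNIV. b j *s B j \<alpha>)) =
        (\<Sum>i\<in>UNIV. \<Sum>j\<in>UNIV. (a i * b j) *s A i (B j \<alpha>))"
    by (simp add: vec.linear_sum[OF A] vec.linear_scale[OF A] vec.scale_sum_right)
  moreover have "(\<Sum>j\<in>UNIV. b j *s B j (\<Sum>i\<in>UNIV. a i *s A i \<alpha>)) =
        (\<Sum>i\<in>UNIV. \<Sum>j\<in>UNIV. (a i * b j) *s B j (A i \<alpha>))"
    by (subst sum.swap)
       (simp add: vec.linear_sum[OF B] vec.linear_scale[OF B] vec.scale_sum_right mult.commute)
  ultimately show ?thesis
    by (simp add: D[symmetric] vec.scale_right_distrib sum.distrib)
qed

lemma of_vector_nth: "of_vector x $ I = (\<Sum>i\<in>UNIV. if I = {i} then x $ i else 0)"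
  by (simp add: of_vector_def axis_def if_distrib cong: if_cong)

lemma wedge_of_vector:
  fixes \<alpha> :: "('k::field, 'n::{finite, linorder}) multivector"
  shows "wedge (of_vector x) \<alpha> = (\<Sum>i\<in>UNIV. x $ i *s raise i \<alpha>)"
proof (subst vec_eq_iff, rule allI)
  fix K :: "'n set"
  have sign: "blade_sign {i} (K - {i}) = (moving_sign i K :: 'k)" for i
  proof -
    have "{(l, j). l \<in> {i} \<and> j \<in> K - {i} \<and> j < l} = Pair i ` {j \<in> K. j < i}" by auto
    then show ?thesis by (simp add: blade_sign_def moving_sign_def card_image inj_on_def)
  qed
  have "wedge (of_vector x) \<alpha> $ K =
      (\<Sum>I \<in> Pow K. \<Sum>i\<in>UNIV. if I = {i} then moving_sign i K * x $ i * \<alpha> $ (K - {i}) else 0)"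
    by (auto simp: wedge_def of_vector_nth sum_distrib_left sum_distrib_right sign intro!: sum.cong)
  also have "\<dots> = (\<Sum>i\<in>UNIV. \<Sum>I \<in> Pow K. if I = {i} then moving_sign i K * x $ i * \<alpha> $ (K - {i}) else 0)"
    by (rule sum.swap)
  also have "\<dots> = (\<Sum>i\<in>UNIV. x $ i *s raise i \<alpha>) $ K"
    by (auto simp: raise_def intro!: sum.cong)
  finally show "wedge (of_vector x) \<alpha> $ K = (\<Sum>i\<in>UNIV. x $ i *s raise i \<alpha>) $ K" .
qed

lemma contraction_eq: "contraction \<omega> \<alpha> = (\<Sum>i\<in>UNIV. \<omega> (axis i 1) *s lower i \<alpha>)"
proof (subst vec_eq_iff, rule allI)
  fix K
  have "contraction \<omega> \<alpha> $ K = (\<Sum>i\<in>-K. \<omega> (axis i 1) * lower i \<alpha> $ K)"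
    by (auto simp: contraction_def lower_def moving_sign_def intro!: sum.cong)
  also have "\<dots> = (\<Sum>i\<in>UNIV. \<omega> (axis i 1) * lower i \<alpha> $ K)"
    by (rule sum.mono_neutral_left) (auto simp: lower_def)
  finally show "contraction \<omega> \<alpha> $ K = (\<Sum>i\<in>UNIV. \<omega> (axis i 1) *s lower i \<alpha>) $ K" by simp
qed

lemma wedge_wedge:
  "wedge (of_vector x) (wedge (of_vector y) \<alpha>) + wedge (of_vector y) (wedge (of_vector x) \<alpha>) = 0"
  using anticommutator_sum[of raise raise \<alpha> "\<lambda>i j. 0", OF linear_raise linear_raise raise_raise]
  by (simp add: wedge_of_vector)

lemma contraction_contraction:
  "contraction \<omega> (contraction \<tau> \<alpha>) + contraction \<tau> (contraction \<omega> \<alpha>) = 0"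
  using anticommutator_sum[of lower lower \<alpha> "\<lambda>i j. 0", OF linear_lower linear_lower lower_lower]
  by (simp add: contraction_eq)

lemma wedge_contraction:
  "wedge (of_vector x) (contraction \<omega> \<alpha>) + contraction \<omega> (wedge (of_vector x) \<alpha>) =
     (\<Sum>i\<in>UNIV. x $ i * \<omega> (axis i 1)) *s \<alpha>"
proof -
  have "(\<Sum>j\<in>UNIV. c j *s (if i = j then \<alpha> else 0)) = c i *s \<alpha>" for c and i :: 'b
    by (simp add: if_distrib[of "\<lambda>v. _ *s v"] cong: if_cong)
  then show ?thesis
    using anticommutator_sum[of raise lower \<alpha> "\<lambda>i j. if i = j then \<alpha> else 0",
        OF linear_raise linear_lower raise_lower, of "\<lambda>i. x $ i" "\<lambda>i. \<omega> (axis i 1)"]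
    by (simp add: wedge_of_vector contraction_eq vec.scale_sum_left)
qed

lemma degree_sign_raise: "degree_sign (raise i \<alpha>) = - raise i (degree_sign \<alpha>)"
proof -
  have "(- 1) ^ card K = - ((- 1) ^ card (K - {i}) :: 'a)" if "i \<in> K" for K
    by (subst card.remove[of K i]) (use that in simp_all)
  then show ?thesis by (auto simp: degree_sign_def raise_def vec_eq_iff)
qed

lemma degree_sign_lower: "degree_sign (lower i \<alpha>) = - lower i (degree_sign \<alpha>)"
  by (auto simp: degree_sign_def lower_def vec_eq_iff)

lemma linear_degree_sign: "Vector_Spaces.linear (*s) (*s) (degree_sign :: ('k::field, 'n::finite) multivector \<Rightarrow> _)"
  by unfold_locales (auto simp: degree_sign_def vec_eq_iff algebra_simps)

lemma degree_sign_wedge: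
  "degree_sign (wedge (of_vector x) \<alpha>) = - wedge (of_vector x) (degree_sign \<alpha>)"
  by (simp add: wedge_of_vector vec.linear_sum[OF linear_degree_sign]
      vec.linear_scale[OF linear_degree_sign] degree_sign_raise sum_negf)

lemma degree_sign_contraction:
  "degree_sign (contraction \<omega> \<alpha>) = - contraction \<omega> (degree_sign \<alpha>)"
  by (simp add: contraction_eq vec.linear_sum[OF linear_degree_sign]
      vec.linear_scale[OF linear_degree_sign] degree_sign_lower sum_negf)

lemma degree_sign_degree_sign: "degree_sign (degree_sign \<alpha>) = \<alpha>"
proof -
  have "(- 1) ^ n * ((- 1) ^ n * x) = x" for n and x :: 'a
    by (cases "even n") simp_all
  then show ?thesis by (simp add: degree_sign_def vec_eq_iff)
qed

lemma linear_wedge: "Vector_Spaces.linear (*s) (*s) (wedge (of_vector x))"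
  unfolding wedge_of_vector
  by (intro vec.linear_compose_sum ballI vec.linear_compose_scale_right linear_raise)

lemma linear_contraction: "Vector_Spaces.linear (*s) (*s) (contraction \<omega>)"
  unfolding contraction_eq
  by (intro vec.linear_compose_sum ballI vec.linear_compose_scale_right linear_lower)

text \<open>
  The operators \<open>raise i \<circ> lower i\<close> and \<open>lower i \<circ> raise i\<close> are the projections onto the coefficients
  of blades with and without \<open>i\<close>. They single out one nonzero coefficient of \<open>\<alpha>\<close>, so \<open>U\<close> contains a
  blade; raising and lowering lead from it to the empty blade and then to every blade.
\<close>
lemma exterior_irreducible:
  fixes U :: "('k::field, 'n::{finite, linorder}) multivector set"
  assumes add: "\<And>\<alpha> \<beta>. \<alpha> \<in> U \<Longrightarrow> \<beta> \<in> U \<Longrightarrow> \<alpha> + \<beta> \<in> U"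
    and scale: "\<And>a \<alpha>. \<alpha> \<in> U \<Longrightarrow> a *s \<alpha> \<in> U"
    and raise: "\<And>i \<alpha>. \<alpha> \<in> U \<Longrightarrow> raise i \<alpha> \<in> U"
    and lower: "\<And>i \<alpha>. \<alpha> \<in> U \<Longrightarrow> lower i \<alpha> \<in> U"
    and \<alpha>: "\<alpha> \<in> U" "\<alpha> \<noteq> 0"
  shows "U = UNIV"
proof -
  obtain K where K: "\<alpha> $ K \<noteq> 0" using \<alpha>(2) by (auto simp: vec_eq_iff)
  \<comment> \<open>\<open>R S\<close> keeps the blades that agree with \<open>K\<close> on the indices in \<open>S\<close>.\<close>
  define R where "R S = (\<chi> I. if I \<inter> S = K \<inter> S then \<alpha> $ I else 0)" for S
  have "R S \<in> U" if "finite S" for S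
    using that
  proof (induction S)
    case empty
    have "R {} = \<alpha>" by (simp add: R_def vec_eq_iff)
    then show ?case using \<alpha>(1) by simp
  next
    case (insert i S)
    have "R (insert i S) = (if i \<in> K then raise i (lower i (R S)) else lower i (raise i (R S)))"
      by (auto simp: R_def raise_def lower_def vec_eq_iff insert_absorb)
    then show ?case using insert.IH raise lower by simp
  qed
  then have "R UNIV \<in> U" by simp
  moreover have "inverse (\<alpha> $ K) *s R UNIV = axis K 1"
    using K by (auto simp: R_def axis_def vec_eq_iff)
  ultimately have bladeK: "axis K 1 \<in> U" using scale by metis
  have "axis I 1 \<in> U \<longleftrightarrow> axis {} 1 \<in> U" if "finite I" for I
    using that
  proof (induction I)
    case (insert i I)
    have lo: "moving_sign i I *s lower i (axis (insert i I) 1) = axis I 1"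
      and ra: "moving_sign i I *s raise i (axis I 1) = axis (insert i I) 1"
      using insert.hyps
      by (auto simp: lower_def raise_def axis_def vec_eq_iff insert_eq_iff)
    then show ?case using insert.IH raise lower scale by metis
  qed simp
  then have blade: "axis I 1 \<in> U" for I using bladeK by auto
  have zero: "0 \<in> U" using scale[OF \<alpha>(1), of 0] by simp
  have "\<beta> \<in> U" for \<beta>
  proof -
    have "(\<Sum>I\<in>S. \<beta> $ I *s axis I 1) \<in> U" if "finite S" for S
      using that by (induction S) (auto intro: add scale blade zero)
    from this[of UNIV] show ?thesis by (simp add: basis_expansion)
  qed
  then show ?thesis by auto
qed

lemma scaleR_eq_of_real: "r *\<^sub>R x = of_real r *s x"
  for x :: "'k::real_field ^ 'n"
  by (simp add: vec_eq_iff) (simp add: scaleR_conv_of_real)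

lemma real_linear:
  fixes f :: "'k::real_field ^ 'm \<Rightarrow> 'k ^ 'n"
  assumes "Vector_Spaces.linear (*s) (*s) f"
  shows "linear f"
  by (simp add: linear_iff scaleR_eq_of_real vec.linear_add[OF assms] vec.linear_scale[OF assms])

lemma multivectors_nontrivial: "(UNIV :: ('k::field, 'n::finite) multivector set) \<noteq> {0}"
proof -
  have "axis {} 1 \<noteq> (0 :: ('k, 'n) multivector)" by (simp add: axis_eq_0_iff)
  then show ?thesis by blast
qed

lemma wedge_wedge_same:
  fixes \<alpha> :: "('k::field_char_0, 'n::{finite, linorder}) multivector"
  shows "wedge (of_vector x) (wedge (of_vector x) \<alpha>) = 0"
  using wedge_wedge[of x x \<alpha>] by (simp add: vec_eq_iff flip: mult_2)

lemma contraction_contraction_same: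
  fixes \<alpha> :: "('k::field_char_0, 'n::{finite, linorder}) multivector"
  shows "contraction \<omega> (contraction \<omega> \<alpha>) = 0"
  using contraction_contraction[of \<omega> \<omega> \<alpha>] by (simp add: vec_eq_iff flip: mult_2)

section \<open>The modules over the definite Clifford algebras in dimensions one to three\<close>

theorem c10_irreducible: "generates_irreducible 1 0 (neg_inner :: real \<Rightarrow> real \<Rightarrow> real) c10"
proof (rule generates_irreducibleI)
  show "has_signature (neg_inner :: real \<Rightarrow> _) 1 0"
    using has_signature_neg_inner[where 'v = real] by simp
  show "clifford_map (neg_inner :: real \<Rightarrow> _) c10"
    by (auto simp: clifford_map_def linear_into_End_def c10_def neg_inner_def linear_iff algebra_simps)
  show "(UNIV :: real set) \<noteq> {0}" using zero_neq_one by blast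
next
  fix U :: "real set" assume U: "subspace U" "U \<noteq> {0}"
  then obtain x where x: "x \<in> U" "x \<noteq> 0" using subspace_0 by blast
  have "y \<in> U" for y
    using subspace_scale[OF U(1) x(1), of "y / x"] x(2) by simp
  then show "U = UNIV" by auto
qed

text \<open>
  On the exterior algebra of a line, exterior multiplication vanishes on degree 1, and contraction
  vanishes on degree 0. This is how the grading operator separates the two.
\<close>
lemma wedge_degree_sign_line:
  fixes \<alpha> :: "('k::field, 1) multivector"
  shows "wedge (of_vector x) (degree_sign \<alpha>) = wedge (of_vector x) \<alpha>"
proof -
  have empty: "K - {i} = {}" for K and i :: 1
    by (auto intro: trans[OF num1_eq1 num1_eq1[symmetric]])
  have "degree_sign \<alpha> $ (K - {i}) = \<alpha> $ (K - {i})" for K and i :: 1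
    unfolding empty by (simp add: degree_sign_def)
  then show ?thesis by (simp add: wedge_of_vector raise_def cong: if_cong)
qed

lemma contraction_degree_sign_line:
  fixes \<alpha> :: "('k::field, 1) multivector"
  shows "contraction \<omega> (degree_sign \<alpha>) = - contraction \<omega> \<alpha>"
proof -
  have singleton: "insert i K = {i}" for K and i :: 1
    by (auto intro: trans[OF num1_eq1 num1_eq1[symmetric]])
  have "degree_sign \<alpha> $ insert i K = - \<alpha> $ insert i K" for K and i :: 1
    unfolding singleton[of i K] by (simp add: degree_sign_def)
  then show ?thesis by (simp add: contraction_eq lower_def vec_eq_iff)
qed

lemma line_irreducible:
  fixes U :: "('k::field, 1) multivector set"
  assumes add: "\<And>\<alpha> \<beta>. \<alpha> \<in> U \<Longrightarrow> \<beta> \<in> U \<Longrightarrow> \<alpha> + \<beta> \<in> U"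
    and scale: "\<And>a \<alpha>. \<alpha> \<in> U \<Longrightarrow> a *s \<alpha> \<in> U"
    and wedge: "\<And>\<alpha>. \<alpha> \<in> U \<Longrightarrow> wedge (of_vector x) \<alpha> \<in> U"
    and contraction: "\<And>\<alpha>. \<alpha> \<in> U \<Longrightarrow> contraction \<omega> \<alpha> \<in> U"
    and nonzero: "x $ 1 \<noteq> 0" "\<omega> (axis 1 1) \<noteq> 0" and \<alpha>: "\<alpha> \<in> U" "\<alpha> \<noteq> 0"
  shows "U = UNIV"
proof (rule exterior_irreducible[OF add scale _ _ \<alpha>])
  fix i :: 1 and \<alpha> assume "\<alpha> \<in> U"
  have "inverse (x $ 1) *s wedge (of_vector x) \<alpha> = raise i \<alpha>"
    using nonzero by (simp add: wedge_of_vector UNIV_1 num1_eq1[of i])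
  then show "raise i \<alpha> \<in> U" using scale[OF wedge[OF \<open>\<alpha> \<in> U\<close>]] by metis
  have "inverse (\<omega> (axis 1 1)) *s contraction \<omega> \<alpha> = lower i \<alpha>"
    using nonzero by (simp add: contraction_eq UNIV_1 num1_eq1[of i])
  then show "lower i \<alpha> \<in> U" using scale[OF contraction[OF \<open>\<alpha> \<in> U\<close>]] by metis
qed

text \<open>
  The relations \<open>(W + C)\<^sup>2 = W C + C W = 1\<close> and \<open>\<epsilon> (W + C) = - (W + C) \<epsilon>\<close> make \<open>c\<close> a Clifford map.
  Conversely \<open>2 W = c e1 + c e1 c e2\<close> and \<open>2 C = c e1 - c e1 c e2\<close>, so stable subspaces are stable
  under \<open>W\<close> and \<open>C\<close>.
\<close>
theorem c20_irreducible:
  fixes e1 e2 :: "real ^ 2" and f1 :: "real ^ 1"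
  assumes e: "neg_inner e1 e1 = - 1" "neg_inner e2 e2 = - 1" "neg_inner e1 e2 = 0" and f: "norm f1 = 1"
  shows "\<exists>!c. is_c20 e1 e2 f1 c" and "is_c20 e1 e2 f1 c \<Longrightarrow> generates_irreducible 2 0 neg_inner c"
proof -
  let ?W = "wedge (of_vector f1)" and ?C = "contraction (\<lambda>y. f1 \<bullet> y)"
  note e = e[unfolded neg_inner_orthonormal]
  have ne: "e1 \<noteq> e2" using e by auto
  have orth: "a \<bullet> b = (if a = b then 1 else 0)" if "a \<in> {e1, e2}" "b \<in> {e1, e2}" for a b
    using that e ne by (auto simp: inner_commute)
  have card: "card {e1, e2} = DIM(real ^ 2)" using ne by simp
  have linW: "linear ?W" and linC: "linear ?C"
    by (rule real_linear[OF linear_wedge]) (rule real_linear[OF linear_contraction])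
  have linE: "linear (degree_sign :: (real, 1) multivector \<Rightarrow> _)"
    by (rule real_linear[OF linear_degree_sign])
  have f_sq: "f1 $ 1 * f1 $ 1 = 1"
    using f by (auto simp: norm_vec_def L2_set_def UNIV_1 abs_if split: if_splits)
  have WC: "?W (?C \<alpha>) + ?C (?W \<alpha>) = \<alpha>" for \<alpha>
    using f_sq by (simp add: wedge_contraction UNIV_1 inner_axis)
  show "\<exists>!c. is_c20 e1 e2 f1 c"
    using ex1_linear_into_End[of "{e1, e2}" "\<lambda>b. if b = e1 then \<lambda>\<alpha>. ?W \<alpha> + ?C \<alpha> else degree_sign", OF orth card]
      linW linC linE ne by (simp add: is_c20_def linear_compose_add)
  assume c: "is_c20 e1 e2 f1 c"
  then have c1: "c e1 \<alpha> = ?W \<alpha> + ?C \<alpha>" and c2: "c e2 \<alpha> = degree_sign \<alpha>" for \<alpha>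
    by (simp_all add: is_c20_def)
  show "generates_irreducible 2 0 neg_inner c"
  proof (rule generates_irreducibleI[OF _ _ multivectors_nontrivial])
    show "has_signature (neg_inner :: real ^ 2 \<Rightarrow> _) 2 0"
      using has_signature_neg_inner[where 'v = "real ^ 2"] by simp
    have "c e1 (c e1 \<alpha>) = \<alpha>" for \<alpha>
      using WC[of \<alpha>]
      by (simp add: c1 linear_add[OF linW] linear_add[OF linC] wedge_wedge_same contraction_contraction_same)
    moreover have "c e2 (c e1 \<alpha>) = - c e1 (c e2 \<alpha>)" for \<alpha>
      by (simp add: c1 c2 linear_add[OF linE] degree_sign_wedge degree_sign_contraction)
    moreover have "c e2 (c e2 \<alpha>) = \<alpha>" for \<alpha>
      by (simp add: c2 degree_sign_degree_sign)
    ultimately show "clifford_map neg_inner c"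
      using c e by (intro clifford_map_on_basis[OF _ bilinear_neg_inner orthonormal_span[OF orth card]])
        (auto simp: is_c20_def neg_inner_def inner_commute scaleR_2)
  next
    fix U assume U: "subspace U" "U \<noteq> {0}" and cU: "\<And>v \<alpha>. \<alpha> \<in> U \<Longrightarrow> c v \<alpha> \<in> U"
    have W: "?W \<alpha> = (1 / 2) *\<^sub>R (c e1 \<alpha> + c e1 (c e2 \<alpha>))"
      and C: "?C \<alpha> = (1 / 2) *\<^sub>R (c e1 \<alpha> - c e1 (c e2 \<alpha>))" for \<alpha>
      by (simp_all add: c1 c2 wedge_degree_sign_line contraction_degree_sign_line flip: scaleR_2)
    obtain \<alpha> where "\<alpha> \<in> U" "\<alpha> \<noteq> 0" using U subspace_0 by blast
    show "U = UNIV"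
    proof (rule line_irreducible[of U f1 "\<lambda>y. f1 \<bullet> y", OF _ _ _ _ _ _ \<open>\<alpha> \<in> U\<close> \<open>\<alpha> \<noteq> 0\<close>])
      show "?W \<beta> \<in> U" "?C \<beta> \<in> U" if "\<beta> \<in> U" for \<beta>
        unfolding W C using U(1) cU that
        by (blast intro: subspace_scale subspace_add subspace_diff)+
    qed (use U f_sq in \<open>auto simp: scalar_mult_eq_scaleR subspace_add subspace_scale inner_axis\<close>)
  qed
qed

text \<open>
  The additional point over the complex numbers is that irreducibility concerns real subspaces. The
  central element \<open>c e1 c e2 c e3\<close> is multiplication by \<open>\<i>\<close>, so stable real subspaces are complex.
\<close>
theorem c30_irreducible:
  fixes e1 e2 e3 :: "real ^ 3" and f1 :: "complex ^ 1"
  assumes e: "neg_inner e1 e1 = - 1" "neg_inner e2 e2 = - 1" "neg_inner e3 e3 = - 1"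
      "neg_inner e1 e2 = 0" "neg_inner e1 e3 = 0" "neg_inner e2 e3 = 0" and f: "norm f1 = 1"
  shows "\<exists>!c. is_c30 e1 e2 e3 f1 c"
    and "is_c30 e1 e2 e3 f1 c \<Longrightarrow> Vector_Spaces.linear (*s) (*s) (c v)"
    and "is_c30 e1 e2 e3 f1 c \<Longrightarrow> generates_irreducible 3 0 neg_inner c"
proof -
  let ?W = "wedge (of_vector f1)" and ?C = "contraction (hermitian_dual f1)"
  note e = e[unfolded neg_inner_orthonormal]
  have ne: "e1 \<noteq> e2" "e1 \<noteq> e3" "e2 \<noteq> e3" using e by auto
  have orth: "a \<bullet> b = (if a = b then 1 else 0)" if "a \<in> {e1, e2, e3}" "b \<in> {e1, e2, e3}" for a b
    using that e ne by (auto simp: inner_commute)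
  have card: "card {e1, e2, e3} = DIM(real ^ 3)" using ne by simp
  note linW = linear_wedge[of f1] and linC = linear_contraction[of "hermitian_dual f1"]
  note linE = linear_degree_sign[where 'k = complex and 'n = 1]
  have lin1: "Vector_Spaces.linear (*s) (*s) (\<lambda>\<alpha>. ?W \<alpha> + ?C \<alpha>)"
    and lin2: "Vector_Spaces.linear (*s) (*s) (\<lambda>\<alpha>. \<i> *s ?W \<alpha> - \<i> *s ?C \<alpha>)"
    by (intro vec.linear_compose_add vec.linear_compose_sub vec.linear_compose_scale_right linW linC)+
  have dual: "hermitian_dual f1 (axis 1 1) = cnj (f1 $ 1)"
    by (simp add: hermitian_dual_def UNIV_1)
  have f_norm: "norm (f1 $ 1) = 1"
    using f by (simp add: norm_vec_def L2_set_def UNIV_1)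
  have f_sq: "f1 $ 1 * cnj (f1 $ 1) = 1"
    using f_norm by (simp add: complex_norm_square[symmetric])
  have WC: "?W (?C \<alpha>) + ?C (?W \<alpha>) = \<alpha>" for \<alpha>
    using f_sq by (simp add: wedge_contraction UNIV_1 dual)
  show "\<exists>!c. is_c30 e1 e2 e3 f1 c"
    using ex1_linear_into_End[of "{e1, e2, e3}" "\<lambda>b. if b = e1 then \<lambda>\<alpha>. ?W \<alpha> + ?C \<alpha>
        else if b = e2 then \<lambda>\<alpha>. \<i> *s ?W \<alpha> - \<i> *s ?C \<alpha> else degree_sign", OF orth card]
      real_linear[OF lin1] real_linear[OF lin2] real_linear[OF linE] ne by (simp add: is_c30_def)
  assume c: "is_c30 e1 e2 e3 f1 c"
  then have c_linear: "linear_into_End c" and c1: "c e1 = (\<lambda>\<alpha>. ?W \<alpha> + ?C \<alpha>)"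
    and c2: "c e2 = (\<lambda>\<alpha>. \<i> *s ?W \<alpha> - \<i> *s ?C \<alpha>)" and c3: "c e3 = degree_sign"
    by (simp_all add: is_c30_def)
  \<comment> \<open>The map is given on a real basis; expanding in it shows that every value is complex linear.\<close>
  have expand: "c v = (\<lambda>\<alpha>. of_real (v \<bullet> e1) *s c e1 \<alpha> + of_real (v \<bullet> e2) *s c e2 \<alpha> + of_real (v \<bullet> e3) *s c e3 \<alpha>)" for v
  proof
    fix \<alpha>
    have lin: "linear (\<lambda>v. c v \<alpha>)" using c_linear by (simp add: linear_into_End_def)
    have "(\<Sum>b\<in>{e1, e2, e3}. (v \<bullet> b) *\<^sub>R b) = v"
      by (rule orthonormal_basis_expand)
         (use orthonormal_span[OF orth card] e in
           \<open>auto simp: pairwise_def orthogonal_def inner_commute norm_eq_1\<close>)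
    then have "c v \<alpha> = c ((v \<bullet> e1) *\<^sub>R e1 + (v \<bullet> e2) *\<^sub>R e2 + (v \<bullet> e3) *\<^sub>R e3) \<alpha>"
      using ne by (simp add: add.assoc)
    also have "\<dots> = (v \<bullet> e1) *\<^sub>R c e1 \<alpha> + (v \<bullet> e2) *\<^sub>R c e2 \<alpha> + (v \<bullet> e3) *\<^sub>R c e3 \<alpha>"
      by (simp add: linear_add[OF lin] linear_scale[OF lin])
    finally show "c v \<alpha> = of_real (v \<bullet> e1) *s c e1 \<alpha> + of_real (v \<bullet> e2) *s c e2 \<alpha> + of_real (v \<bullet> e3) *s c e3 \<alpha>"
      by (simp add: vec_eq_iff) (simp add: scaleR_conv_of_real)
  qed
  show "Vector_Spaces.linear (*s) (*s) (c v)"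
    unfolding expand[of v] unfolding c1 c2 c3
    by (intro vec.linear_compose_add[of "\<lambda>x. _ x + _ x"] vec.linear_compose_add vec.linear_compose_scale_right lin1 lin2 linE)
  note lins = vec.linear_add[OF linW] vec.linear_add[OF linC] vec.linear_add[OF linE]
    vec.linear_diff[OF linW] vec.linear_diff[OF linC] vec.linear_diff[OF linE]
    vec.linear_scale[OF linW] vec.linear_scale[OF linC] vec.linear_scale[OF linE]
    vec.linear_neg[OF linW] vec.linear_neg[OF linC] vec.linear_neg[OF linE]
  show "generates_irreducible 3 0 neg_inner c"
  proof (rule generates_irreducibleI[OF _ _ multivectors_nontrivial])
    show "has_signature (neg_inner :: real ^ 3 \<Rightarrow> _) 3 0"
      using has_signature_neg_inner[where 'v = "real ^ 3"] by simp
    have "c e1 (c e1 \<alpha>) = \<alpha>" for \<alpha>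
      using WC[of \<alpha>] by (simp add: c1 lins wedge_wedge_same contraction_contraction_same)
    moreover have "c e2 (c e2 \<alpha>) = \<alpha>" for \<alpha>
      using WC[of \<alpha>]
      by (simp add: c2 lins wedge_wedge_same contraction_contraction_same vec.scale_right_diff_distrib add.commute)
    moreover have "c e3 (c e3 \<alpha>) = \<alpha>" for \<alpha>
      by (simp add: c3 degree_sign_degree_sign)
    moreover have "c e2 (c e1 \<alpha>) = - c e1 (c e2 \<alpha>)" for \<alpha>
      by (simp add: c1 c2 lins wedge_wedge_same contraction_contraction_same algebra_simps)
    moreover have "c e3 (c e1 \<alpha>) = - c e1 (c e3 \<alpha>)" for \<alpha>
      by (simp add: c1 c3 lins degree_sign_wedge degree_sign_contraction)
    moreover have "c e3 (c e2 \<alpha>) = - c e2 (c e3 \<alpha>)" for \<alpha>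
      by (simp add: c2 c3 lins degree_sign_wedge degree_sign_contraction)
    ultimately show "clifford_map neg_inner c"
      using c_linear e
      by (intro clifford_map_on_basis[OF _ bilinear_neg_inner orthonormal_span[OF orth card]])
        (auto simp: neg_inner_def inner_commute scaleR_2)
  next
    fix U assume U: "subspace U" "U \<noteq> {0}" and cU: "\<And>v \<alpha>. \<alpha> \<in> U \<Longrightarrow> c v \<alpha> \<in> U"
    have W: "?W \<alpha> = (1 / 2) *\<^sub>R (c e1 \<alpha> + c e1 (c e3 \<alpha>))"
      and C: "?C \<alpha> = (1 / 2) *\<^sub>R (c e1 \<alpha> - c e1 (c e3 \<alpha>))" for \<alpha>
      by (simp_all add: c1 c3 wedge_degree_sign_line contraction_degree_sign_line flip: scaleR_2)
    have i: "c e1 (c e2 (c e3 \<alpha>)) = \<i> *s \<alpha>" for \<alpha>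
    proof -
      have "c e1 (c e2 (c e3 \<alpha>)) = \<i> *s (?W (?C \<alpha>) + ?C (?W \<alpha>))"
        by (simp add: c1 c2 c3 lins wedge_degree_sign_line contraction_degree_sign_line
            wedge_wedge_same contraction_contraction_same vec.scale_right_distrib)
      then show ?thesis by (simp only: WC)
    qed
    have scale: "a *s \<beta> \<in> U" if "\<beta> \<in> U" for a \<beta>
    proof -
      have "a *s \<beta> = Re a *\<^sub>R \<beta> + Im a *\<^sub>R c e1 (c e2 (c e3 \<beta>))"
        unfolding i by (simp add: vec_eq_iff complex_eq_iff)
      also have "\<dots> \<in> U" using that U(1) cU by (intro subspace_add subspace_scale) auto
      finally show ?thesis .
    qed
    obtain \<alpha> where "\<alpha> \<in> U" "\<alpha> \<noteq> 0" using U subspace_0 by blast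
    show "U = UNIV"
    proof (rule line_irreducible[of U f1 "hermitian_dual f1", OF _ _ _ _ _ _ \<open>\<alpha> \<in> U\<close> \<open>\<alpha> \<noteq> 0\<close>])
      show "?W \<beta> \<in> U" "?C \<beta> \<in> U" if "\<beta> \<in> U" for \<beta>
        unfolding W C using U(1) cU that
        by (blast intro: subspace_scale subspace_add subspace_diff)+
    qed (use U f_norm scale in \<open>auto simp: subspace_add dual\<close>)
  qed
qed

section \<open>The quaternionic module\<close>

lemma vector_4 [simp]:
  "(vector [a, b, c, d] :: 'a::zero ^ 4) $ 1 = a"
  "(vector [a, b, c, d] :: 'a::zero ^ 4) $ 2 = b"
  "(vector [a, b, c, d] :: 'a::zero ^ 4) $ 3 = c"
  "(vector [a, b, c, d] :: 'a::zero ^ 4) $ 4 = d"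
  by (simp_all add: vector_def)

lemma quaternion_eq_iff: "(p :: quaternion) = q \<longleftrightarrow> p$1 = q$1 \<and> p$2 = q$2 \<and> p$3 = q$3 \<and> p$4 = q$4"
  by (simp add: vec_eq_iff forall_4)

lemma qmult_assoc: "qmult (qmult p q) r = qmult p (qmult q r)"
  by (simp add: quaternion_eq_iff qmult_def algebra_simps)

lemma qmult_add: "qmult (p + q) r = qmult p r + qmult q r" "qmult r (p + q) = qmult r p + qmult r q"
  by (simp_all add: quaternion_eq_iff qmult_def algebra_simps)

lemma qmult_scaleR: "qmult (a *\<^sub>R p) q = a *\<^sub>R qmult p q" "qmult p (a *\<^sub>R q) = a *\<^sub>R qmult p q"
  by (simp_all add: quaternion_eq_iff qmult_def algebra_simps)

lemma qcnj_add: "qcnj (p + q) = qcnj p + qcnj q"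
  by (simp add: quaternion_eq_iff qcnj_def)

lemma qcnj_scaleR: "qcnj (a *\<^sub>R p) = a *\<^sub>R qcnj p"
  by (simp add: quaternion_eq_iff qcnj_def)

lemma qcnj_qmult: "qcnj (qmult p q) = qmult (qcnj q) (qcnj p)"
  by (simp add: quaternion_eq_iff qcnj_def qmult_def algebra_simps)

lemma qcnj_qcnj [simp]: "qcnj (qcnj q) = q"
  by (simp add: quaternion_eq_iff qcnj_def)

lemma qmult_zero [simp]: "qmult 0 q = 0" "qmult q 0 = 0"
  by (simp_all add: quaternion_eq_iff qmult_def)

lemma quaternion_polarization:
  "qmult (qcnj p) q + qmult (qcnj q) p = (2 * (p \<bullet> q)) *\<^sub>R axis 1 1"
  "qmult p (qcnj q) + qmult q (qcnj p) = (2 * (p \<bullet> q)) *\<^sub>R axis 1 1"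
  by (simp_all add: quaternion_eq_iff qmult_def qcnj_def inner_vec_def sum_4 axis_def algebra_simps)

lemma qmult_one [simp]: "qmult (axis 1 1) q = q" "qmult q (axis 1 1) = q"
  by (simp_all add: quaternion_eq_iff qmult_def axis_def)

lemma qcnj_qmult_self: "qmult (qcnj q) q = (q \<bullet> q) *\<^sub>R axis 1 1"
  using quaternion_polarization(1)[of q q] by (simp add: vec_eq_iff)

lemma c40_apply: "c40 q (a, b) = (qmult (qcnj q) b, qmult q a)"
  by (simp add: c40_def qexterior_left_def qcontraction_left_def)

text \<open>
  The product of the four generators is the grading of the exterior algebra.
\<close>
lemma c40_volume:
  "c40 (axis 1 1) (c40 (axis 2 1) (c40 (axis 3 1) (c40 (axis 4 1) (a, b)))) = (a, - b)"
  by (simp add: c40_apply quaternion_eq_iff qmult_def qcnj_def axis_def)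

theorem c40_right_linear: "right_quaternion_linear (c40 q)"
  by (auto simp: right_quaternion_linear_def c40_apply qmult_add qmult_assoc)

text \<open>
  By the volume element, a stable subspace contains both components of each of its elements. If
  \<open>b \<noteq> 0\<close> then every quaternion has the form \<open>qcnj q * b\<close>, with \<open>q\<close> proportional to \<open>b * qcnj h\<close> for
  the quaternion \<open>h\<close> to be reached; so one nonzero component generates the whole of the other degree,
  and then that degree generates the first.
\<close>
theorem c40_irreducible: "generates_irreducible 4 0 neg_inner c40"
proof (rule generates_irreducibleI)
  show "has_signature (neg_inner :: quaternion \<Rightarrow> _) 4 0"
    using has_signature_neg_inner[where 'v = quaternion] by simp
  show "(UNIV :: quaternionic_multivector set) \<noteq> {0}"
  proof -
    have "(axis 1 1, 0) \<noteq> (0 :: quaternionic_multivector)" by (simp add: zero_prod_def axis_eq_0_iff)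
    then show ?thesis by blast
  qed
  show "clifford_map neg_inner c40"
    unfolding clifford_map_def
  proof (intro conjI allI)
    show "linear_into_End c40"
      by (auto simp: linear_into_End_def linear_iff c40_apply qmult_add qmult_scaleR qcnj_add qcnj_scaleR)
    fix v w :: quaternion and x :: quaternionic_multivector
    obtain a b where x: "x = (a, b)" by (cases x)
    have "qmult (qcnj v) (qmult w a) + qmult (qcnj w) (qmult v a) = (2 * (v \<bullet> w)) *\<^sub>R a"
      and "qmult v (qmult (qcnj w) b) + qmult w (qmult (qcnj v) b) = (2 * (v \<bullet> w)) *\<^sub>R b"
      by (simp_all add: quaternion_polarization qmult_scaleR flip: qmult_assoc qmult_add)
    then show "c40 v (c40 w x) + c40 w (c40 v x) = - (2 * neg_inner v w) *\<^sub>R x"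
      by (simp add: x c40_apply neg_inner_def)
  qed
next
  fix U :: "quaternionic_multivector set"
  assume U: "subspace U" "U \<noteq> {0}" and cU: "\<And>v x. x \<in> U \<Longrightarrow> c40 v x \<in> U"
  have first: "(a, 0) \<in> U" and second: "(0, b) \<in> U" if "(a, b) \<in> U" for a b
  proof -
    have "(a, - b) \<in> U" using cU that by (metis c40_volume)
    then have "(1 / 2) *\<^sub>R ((a, b) + (a, - b)) \<in> U" "(1 / 2) *\<^sub>R ((a, b) - (a, - b)) \<in> U"
      using that U(1) by (auto intro!: subspace_scale subspace_add subspace_diff simp del: add_Pair diff_Pair)
    then show "(a, 0) \<in> U" "(0, b) \<in> U" by (simp_all flip: scaleR_2)
  qed
  have up: "(0, h) \<in> U" if "(a, 0) \<in> U" "a \<noteq> 0" for a h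
  proof -
    have "(1 / (a \<bullet> a)) *\<^sub>R c40 (qmult h (qcnj a)) (a, 0) \<in> U"
      using U(1) cU[OF that(1)] by (rule subspace_scale)
    then show ?thesis using that(2) by (simp add: c40_apply qmult_assoc qcnj_qmult_self qmult_scaleR)
  qed
  have down: "(h, 0) \<in> U" if "(0, b) \<in> U" "b \<noteq> 0" for b h
  proof -
    have "(1 / (b \<bullet> b)) *\<^sub>R c40 (qmult b (qcnj h)) (0, b) \<in> U"
      using U(1) cU[OF that(1)] by (rule subspace_scale)
    then show ?thesis
      using that(2) by (simp add: c40_apply qcnj_qmult qmult_assoc qcnj_qmult_self qmult_scaleR)
  qed
  have one: "(axis 1 1 :: quaternion) \<noteq> 0" by (simp add: axis_eq_0_iff)
  obtain x where "x \<in> U" "x \<noteq> 0" using U subspace_0 by blast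
  then obtain a b where ab: "(a, b) \<in> U" "a \<noteq> 0 \<or> b \<noteq> 0"
    by (cases x) (auto simp: zero_prod_def)
  then have "(h, 0) \<in> U" "(0, h) \<in> U" for h
    using up down first[OF ab(1)] second[OF ab(1)] one by metis+
  then have "(a, b) \<in> U" for a b
    using subspace_add[OF U(1), of "(a, 0)" "(0, b)"] by simp
  then show "U = UNIV" by auto
qed

section \<open>The split case\<close>

lemma independent_orthogonal:
  fixes g :: "'v::real_vector \<Rightarrow> 'v \<Rightarrow> real"
  assumes lin: "\<And>v. linear (g v)" and "finite S"
    and orth: "\<And>v w. v \<in> S \<Longrightarrow> w \<in> S \<Longrightarrow> v \<noteq> w \<Longrightarrow> g v w = 0"
    and nonnull: "\<And>v. v \<in> S \<Longrightarrow> g v v \<noteq> 0"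
  shows "independent S"
proof (rule independent_if_scalars_zero[OF \<open>finite S\<close>])
  fix f v assume sum: "(\<Sum>w\<in>S. f w *\<^sub>R w) = 0" and v: "v \<in> S"
  have "0 = g v (\<Sum>w\<in>S. f w *\<^sub>R w)" using sum linear_0[OF lin] by simp
  also have "\<dots> = (\<Sum>w\<in>S. if w = v then f v * g v v else 0)"
    using orth[OF v] by (auto simp: linear_sum[OF lin] linear_scale[OF lin] intro!: sum.cong)
  finally show "f v = 0" using v nonnull[OF v] \<open>finite S\<close> by simp
qed

definition covector :: "'n::finite \<Rightarrow> (real ^ 'n) \<Rightarrow>\<^sub>L real" where
  "covector i = blinfun_inner_left (axis i 1)"

lemma covector_apply [simp]: "blinfun_apply (covector i) x = x $ i"
  by (simp add: covector_def inner_axis)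

lemma blinfun_eq_sum_covectors:
  fixes \<omega> :: "(real ^ 'n::finite) \<Rightarrow>\<^sub>L real"
  shows "\<omega> = (\<Sum>i\<in>UNIV. blinfun_apply \<omega> (axis i 1) *\<^sub>R covector i)"
proof (rule blinfun_eqI)
  fix x :: "real ^ 'n"
  have "blinfun_apply \<omega> x = blinfun_apply \<omega> (\<Sum>i\<in>UNIV. x $ i *\<^sub>R axis i 1)"
    by (simp add: basis_expansion flip: scalar_mult_eq_scaleR)
  then show "blinfun_apply \<omega> x = blinfun_apply (\<Sum>i\<in>UNIV. blinfun_apply \<omega> (axis i 1) *\<^sub>R covector i) x"
    by (simp add: blinfun.sum_left blinfun.sum_right blinfun.scaleR_left blinfun.scaleR_right mult.commute)
qed

lemma bilinear_pairing_metric: "bilinear pairing_metric"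
  by (auto simp: bilinear_def linear_iff pairing_metric_def blinfun.add_left blinfun.add_right
      blinfun.scaleR_left blinfun.scaleR_right algebra_simps)

text \<open>
  The vectors \<open>(e\<^sub>i, \<plusminus> dual e\<^sub>i) / k\<close> have square \<open>\<plusminus>1\<close> and are orthogonal. The scale \<open>k\<close> covers both
  metrics of interest: \<open>k = sqrt 2\<close> is the pairing metric, \<open>k = 1\<close> its half.
\<close>
lemma has_signature_pairing:
  fixes k :: real
  assumes k: "k > 0"
  shows "has_signature (\<lambda>v w :: 'n::finite split_space. k\<^sup>2 / 2 * pairing_metric v w) CARD('n) CARD('n)"
proof -
  define g where "g = (\<lambda>v w :: 'n split_space. k\<^sup>2 / 2 * pairing_metric v w)"
  define p :: "'n \<Rightarrow> 'n split_space" where "p i = (1 / k) *\<^sub>R (axis i 1, covector i)" for i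
  define m :: "'n \<Rightarrow> 'n split_space" where "m i = (1 / k) *\<^sub>R (axis i 1, - covector i)" for i
  have pp: "g (p i) (p j) = (if i = j then 1 else 0)"
    and mm: "g (m i) (m j) = (if i = j then - 1 else 0)"
    and pm: "g (p i) (m j) = 0" and mp: "g (m i) (p j) = 0" for i j
    using k by (auto simp: g_def p_def m_def pairing_metric_def blinfun.scaleR_left blinfun.scaleR_right
        blinfun.minus_left axis_def power2_eq_square)
  have lin: "linear (g v)" for v
  proof -
    have "linear (pairing_metric v)"
      using bilinear_pairing_metric unfolding bilinear_def by blast
    from linear_compose_scale_right[OF this, of "k\<^sup>2 / 2"] show ?thesis
      by (simp add: g_def)
  qed
  have sym: "g v w = g w v" for v w
    by (auto simp: g_def pairing_metric_def split: prod.split)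
  have inj: "inj p" "inj m"
    by (rule injI, metis pp zero_neq_one) (rule injI, metis mm zero_neq_neg_one)
  have disjoint: "range m \<inter> range p = {}"
  proof (rule equals0I)
    fix v assume "v \<in> range m \<inter> range p"
    then obtain i j where "v = m i" "v = p j" by blast
    then have "g (m i) (m i) = g (m i) (p j)" by simp
    then show False by (simp add: mm mp)
  qed
  have metric: "g v w = (if v \<noteq> w then 0 else if v \<in> range m then - 1 else 1)"
    if "v \<in> range m \<union> range p" "w \<in> range m \<union> range p" for v w
    using that disjoint by (auto simp: pp mm pm mp inj_eq[OF inj(1)] inj_eq[OF inj(2)])
  have "independent (range m \<union> range p)"
    by (rule independent_orthogonal[of g]) (auto simp: lin metric)
  moreover have "span (range m \<union> range p) = UNIV"
  proof -
    have "(x, \<omega>) \<in> span (range m \<union> range p)" for x \<omega>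
    proof -
      have vector: "(axis i 1, 0) = (k / 2) *\<^sub>R (p i + m i)"
        and dual: "(0, covector i) = (k / 2) *\<^sub>R (p i - m i)" for i
        using k by (simp_all add: p_def m_def scaleR_add_right[symmetric] scaleR_diff_right[symmetric]
            scaleR_2[symmetric] zero_prod_def[symmetric])
      have "(axis i 1, 0) \<in> span (range m \<union> range p)" "(0, covector i) \<in> span (range m \<union> range p)" for i
        unfolding vector dual
        by (intro span_scale span_add span_diff span_base; blast)+
      then have "(\<Sum>i\<in>UNIV. x $ i *\<^sub>R (axis i 1, 0)) +
          (\<Sum>i\<in>UNIV. blinfun_apply \<omega> (axis i 1) *\<^sub>R (0, covector i)) \<in> span (range m \<union> range p)"
        by (intro span_add span_sum span_scale) auto
      moreover have "(\<Sum>i\<in>UNIV. x $ i *\<^sub>R axis i 1) = x"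
        by (simp add: basis_expansion flip: scalar_mult_eq_scaleR)
      ultimately show ?thesis
        using blinfun_eq_sum_covectors[of \<omega>]
        by (simp add: sum_prod)
    qed
    then show ?thesis by auto
  qed
  ultimately have "has_signature g CARD('n) CARD('n)"
    unfolding has_signature_def using lin sym metric disjoint
    by (intro conjI exI[of _ "range m"] exI[of _ "range p"])
       (auto simp: card_image[OF inj(1)] card_image[OF inj(2)])
  then show ?thesis by (simp add: g_def)
qed

text \<open>
  As eigenspaces of the grading operator, the even and odd multivectors are exchanged by any operator
  that anticommutes with it.
\<close>
lemma even_multivectors_eq:
  "even_multivectors = {\<alpha> :: ('k::field_char_0, 'n::finite) multivector. degree_sign \<alpha> = \<alpha>}"
  by (auto simp: even_multivectors_def degree_sign_def vec_eq_iff minus_one_power_iff)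

lemma odd_multivectors_eq:
  "odd_multivectors = {\<alpha> :: ('k::field_char_0, 'n::finite) multivector. degree_sign \<alpha> = - \<alpha>}"
  by (auto simp: odd_multivectors_def degree_sign_def vec_eq_iff minus_one_power_iff)

text \<open>
  In the anticommutator of \<open>wedge x - contraction \<omega>\<close> and \<open>wedge y - contraction \<tau>\<close> only the mixed
  terms survive, and they contribute \<open>- \<tau> x - \<omega> y\<close>.
\<close>
lemma cii_relation:
  fixes v w :: "'n::{finite, linorder} split_space"
  shows "cii v (cii w \<alpha>) + cii w (cii v \<alpha>) = - pairing_metric v w *\<^sub>R \<alpha>"
proof -
  obtain x \<omega> y \<tau> where v: "v = (x, \<omega>)" and w: "w = (y, \<tau>)" by (cases v, cases w)
  have value_eq: "(\<Sum>i\<in>UNIV. x $ i * blinfun_apply \<omega> (axis i 1)) = blinfun_apply \<omega> x" for x and \<omega> :: "(real, 'n) vec \<Rightarrow>\<^sub>L real"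
    by (subst (2) blinfun_eq_sum_covectors[of \<omega>])
       (simp add: blinfun.sum_left blinfun.scaleR_left mult.commute)
  have "cii v (cii w \<alpha>) + cii w (cii v \<alpha>) =
      (wedge (of_vector x) (wedge (of_vector y) \<alpha>) + wedge (of_vector y) (wedge (of_vector x) \<alpha>)) +
      (contraction \<omega> (contraction \<tau> \<alpha>) + contraction \<tau> (contraction \<omega> \<alpha>)) -
      (wedge (of_vector x) (contraction \<tau> \<alpha>) + contraction \<tau> (wedge (of_vector x) \<alpha>)) -
      (wedge (of_vector y) (contraction \<omega> \<alpha>) + contraction \<omega> (wedge (of_vector y) \<alpha>))"
    by (simp add: cii_def v w vec.linear_diff[OF linear_wedge] vec.linear_diff[OF linear_contraction])
  also have "\<dots> = - pairing_metric v w *\<^sub>R \<alpha>"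
    unfolding wedge_wedge contraction_contraction wedge_contraction value_eq
    by (simp add: v w pairing_metric_def scalar_mult_eq_scaleR algebra_simps)
  finally show ?thesis .
qed

lemma linear_into_End_cii: "linear_into_End (cii :: 'n::{finite, linorder} split_space \<Rightarrow> _)"
  unfolding linear_into_End_def
proof (intro conjI allI)
  fix v :: "'n split_space"
  show "linear (cii v)"
    by (cases v) (simp add: cii_def linear_compose_sub real_linear linear_wedge linear_contraction)
  fix \<alpha> :: "(real, 'n) multivector"
  show "linear (\<lambda>v. cii v \<alpha>)"
    by (auto simp: linear_iff cii_def wedge_of_vector contraction_eq blinfun.add_left blinfun.scaleR_left
        scalar_mult_eq_scaleR scaleR_add_left sum.distrib scaleR_sum_right algebra_simps)
qed

text \<open>
  Scaling \<open>cii\<close> by \<open>k\<close> scales its Clifford form by \<open>k\<^sup>2\<close> and leaves the stable subspaces unchanged.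
  The vectors \<open>(e\<^sub>i, 0)\<close> and \<open>(0, - dual e\<^sub>i)\<close> act through \<open>cii\<close> as \<open>raise i\<close> and \<open>lower i\<close>.
\<close>
theorem cii_irreducible:
  fixes k :: real
  assumes k: "k > 0"
  shows "generates_graded_irreducible CARD('n) CARD('n)
    (\<lambda>v w :: 'n::{finite, linorder} split_space. k\<^sup>2 / 2 * pairing_metric v w)
    (\<lambda>v \<alpha>. k *\<^sub>R cii v \<alpha>) even_multivectors odd_multivectors"
proof (rule generates_graded_irreducibleI[OF has_signature_pairing[OF k]])
  have lin: "linear (cii v)" "linear (\<lambda>v. cii v \<alpha>)" for v :: "'n split_space" and \<alpha>
    using linear_into_End_cii unfolding linear_into_End_def by blast+
  show "clifford_map (\<lambda>v w :: 'n split_space. k\<^sup>2 / 2 * pairing_metric v w) (\<lambda>v \<alpha>. k *\<^sub>R cii v \<alpha>)"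
    unfolding clifford_map_def linear_into_End_def
  proof (intro conjI allI)
    fix v w :: "'n split_space" and \<alpha>
    have "k *\<^sub>R cii v (k *\<^sub>R cii w \<alpha>) + k *\<^sub>R cii w (k *\<^sub>R cii v \<alpha>) =
        k\<^sup>2 *\<^sub>R (cii v (cii w \<alpha>) + cii w (cii v \<alpha>))"
      by (simp add: linear_scale[OF lin(1)] power2_eq_square scaleR_add_right)
    then show "k *\<^sub>R cii v (k *\<^sub>R cii w \<alpha>) + k *\<^sub>R cii w (k *\<^sub>R cii v \<alpha>) =
        - (2 * (k\<^sup>2 / 2 * pairing_metric v w)) *\<^sub>R \<alpha>"
      by (simp add: cii_relation)
  qed (intro linear_compose_scale_right lin)+
  show "(UNIV :: (real, 'n) multivector set) \<noteq> {0}" by (rule multivectors_nontrivial)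
next
  fix U :: "(real, 'n) multivector set"
  assume U: "subspace U" "U \<noteq> {0}" and cU: "\<And>v \<alpha>. \<alpha> \<in> U \<Longrightarrow> k *\<^sub>R cii v \<alpha> \<in> U"
  have cii: "cii v \<alpha> \<in> U" if "\<alpha> \<in> U" for v \<alpha>
    using subspace_scale[OF U(1) cU[OF that, of v], of "1 / k"] k by simp
  obtain \<alpha> where "\<alpha> \<in> U" "\<alpha> \<noteq> 0" using U subspace_0 by blast
  show "U = UNIV"
  proof (rule exterior_irreducible[OF _ _ _ _ \<open>\<alpha> \<in> U\<close> \<open>\<alpha> \<noteq> 0\<close>])
    fix i and \<beta> assume \<beta>: "\<beta> \<in> U"
    have "cii (axis i 1, 0) \<beta> = raise i \<beta>"
      by (simp add: cii_def wedge_of_vector contraction_eq axis_def if_distrib[of "\<lambda>a. a *s _"] cong: if_cong)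
    then show "raise i \<beta> \<in> U" using cii[OF \<beta>] by metis
    have "cii (0, - covector i) \<beta> = lower i \<beta>"
      by (simp add: cii_def wedge_of_vector contraction_eq blinfun.minus_left axis_def sum_negf
          if_distrib[of "\<lambda>a. a *s _"] cong: if_cong)
    then show "lower i \<beta> \<in> U" using cii[OF \<beta>] by metis
  qed (use U(1) in \<open>auto simp: scalar_mult_eq_scaleR subspace_add subspace_scale\<close>)
next
  have linE: "linear (degree_sign :: (real, 'n) multivector \<Rightarrow> _)"
    by (rule real_linear[OF linear_degree_sign])
  have lin: "linear (cii v)" for v :: "'n split_space"
    using linear_into_End_cii unfolding linear_into_End_def by blast
  show "subspace (even_multivectors :: (real, 'n) multivector set)"
    and "subspace (odd_multivectors :: (real, 'n) multivector set)"
    by (auto simp: even_multivectors_def odd_multivectors_def subspace_def)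
  show "even_multivectors \<inter> odd_multivectors = {0 :: (real, 'n) multivector}"
    by (auto simp: even_multivectors_def odd_multivectors_def vec_eq_iff) metis
  show "\<exists>\<beta> \<in> even_multivectors. \<exists>\<gamma> \<in> odd_multivectors. \<alpha> = \<beta> + \<gamma>" for \<alpha> :: "(real, 'n) multivector"
    by (rule bexI[of _ "\<chi> I. if even (card I) then \<alpha> $ I else 0"],
        rule bexI[of _ "\<chi> I. if even (card I) then 0 else \<alpha> $ I"])
       (auto simp: even_multivectors_def odd_multivectors_def vec_eq_iff)
  have anti: "degree_sign (k *\<^sub>R cii v \<alpha>) = - k *\<^sub>R cii v (degree_sign \<alpha>)" for v :: "'n split_space" and \<alpha>
    by (cases v) (simp add: cii_def linear_scale[OF linE] linear_diff[OF linE] degree_sign_wedge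
        degree_sign_contraction scaleR_diff_right)
  show "k *\<^sub>R cii v \<alpha> \<in> odd_multivectors" if "\<alpha> \<in> even_multivectors" for v :: "'n split_space" and \<alpha>
    using that anti[of v \<alpha>] by (simp add: even_multivectors_eq odd_multivectors_eq)
  show "k *\<^sub>R cii v \<alpha> \<in> even_multivectors" if "\<alpha> \<in> odd_multivectors" for v :: "'n split_space" and \<alpha>
    using that anti[of v \<alpha>] linear_neg[OF lin]
    by (simp add: even_multivectors_eq odd_multivectors_eq)
qed

section \<open>All five modules\<close>

theorem mainTheorem14:
  shows
    "generates_irreducible 1 0 (neg_inner :: real \<Rightarrow> real \<Rightarrow> real) c10
     \<and>
     (\<forall>(e1 :: real ^ 2) e2 (f1 :: real ^ 1).
        neg_inner e1 e1 = - 1 \<and> neg_inner e2 e2 = - 1 \<and> neg_inner e1 e2 = 0 \<and> norm f1 = 1 \<longrightarrow>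
        (\<exists>!c. is_c20 e1 e2 f1 c) \<and>
        (\<forall>c. is_c20 e1 e2 f1 c \<longrightarrow> generates_irreducible 2 0 neg_inner c))
     \<and>
     (\<forall>(e1 :: real ^ 3) e2 e3 (f1 :: complex ^ 1).
        neg_inner e1 e1 = - 1 \<and> neg_inner e2 e2 = - 1 \<and> neg_inner e3 e3 = - 1 \<and>
        neg_inner e1 e2 = 0 \<and> neg_inner e1 e3 = 0 \<and> neg_inner e2 e3 = 0 \<and> norm f1 = 1 \<longrightarrow>
        (\<exists>!c. is_c30 e1 e2 e3 f1 c) \<and>
        (\<forall>c. is_c30 e1 e2 e3 f1 c \<longrightarrow>
           (\<forall>v. Vector_Spaces.linear (*s) (*s) (c v)) \<and>
           generates_irreducible 3 0 neg_inner c))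
     \<and>
     ((\<forall>q. right_quaternion_linear (c40 q)) \<and> generates_irreducible 4 0 neg_inner c40)
     \<and>
     (has_signature (pairing_metric :: 'n::{finite, linorder} split_space \<Rightarrow> _ \<Rightarrow> real)
        CARD('n) CARD('n) \<and>
      generates_graded_irreducible CARD('n) CARD('n)
        (half_pairing_metric :: 'n split_space \<Rightarrow> _ \<Rightarrow> real)
        cii even_multivectors odd_multivectors \<and>
      generates_graded_irreducible CARD('n) CARD('n)
        (pairing_metric :: 'n split_space \<Rightarrow> _ \<Rightarrow> real)
        (\<lambda>v \<alpha>. sqrt 2 *\<^sub>R cii v \<alpha>) even_multivectors odd_multivectors)"
proof (intro conjI allI impI; (elim conjE)?)
  show "generates_irreducible 1 0 (neg_inner :: real \<Rightarrow> real \<Rightarrow> real) c10"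
    by (rule c10_irreducible)
next
  fix e1 e2 :: "real ^ 2" and f1 :: "real ^ 1"
  assume h: "neg_inner e1 e1 = - 1" "neg_inner e2 e2 = - 1" "neg_inner e1 e2 = 0" "norm f1 = 1"
  show "\<exists>!c. is_c20 e1 e2 f1 c"
    by (rule c20_irreducible(1)[OF h])
  show "generates_irreducible 2 0 neg_inner c" if "is_c20 e1 e2 f1 c" for c
    by (rule c20_irreducible(2)[OF h that])
next
  fix e1 e2 e3 :: "real ^ 3" and f1 :: "complex ^ 1"
  assume h: "neg_inner e1 e1 = - 1" "neg_inner e2 e2 = - 1" "neg_inner e3 e3 = - 1"
    "neg_inner e1 e2 = 0" "neg_inner e1 e3 = 0" "neg_inner e2 e3 = 0" "norm f1 = 1"
  show "\<exists>!c. is_c30 e1 e2 e3 f1 c"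
    by (rule c30_irreducible(1)[OF h])
  show "Vector_Spaces.linear (*s) (*s) (c v)" if "is_c30 e1 e2 e3 f1 c" for c v
    by (rule c30_irreducible(2)[OF h that])
  show "generates_irreducible 3 0 neg_inner c" if "is_c30 e1 e2 e3 f1 c" for c
    by (rule c30_irreducible(3)[OF h that])
next
  show "right_quaternion_linear (c40 q)" for q
    by (rule c40_right_linear)
  show "generates_irreducible 4 0 neg_inner c40"
    by (rule c40_irreducible)
next
  show "has_signature (pairing_metric :: 'n split_space \<Rightarrow> _) CARD('n) CARD('n)"
    using has_signature_pairing[of "sqrt 2", where 'n = 'n] by simp
  show "generates_graded_irreducible CARD('n) CARD('n) (half_pairing_metric :: 'n split_space \<Rightarrow> _)
      cii even_multivectors odd_multivectors"
    using cii_irreducible[of 1, where 'n = 'n] by (simp add: half_pairing_metric_def[abs_def])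
  show "generates_graded_irreducible CARD('n) CARD('n) (pairing_metric :: 'n split_space \<Rightarrow> _)
      (\<lambda>v \<alpha>. sqrt 2 *\<^sub>R cii v \<alpha>) even_multivectors odd_multivectors"
    using cii_irreducible[of "sqrt 2", where 'n = 'n] by simp
qed

end
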